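(* Let $d$ be a positive integer, let $X=\binom{[2d]}{d}$, and fix $x\in X$. Let $\mathcal{T}$ be the Terwilliger algebra of the Johnson scheme $J(2d,d)$ with respect to $x$, and let $\mathcal{N}=\bigoplus_{i,j=0}^{d}L(N_{i,j})\subseteq\mathrm{Mat}_X(\mathbb{C})$. Then $\mathcal{T}=\mathcal{N}$.
   Context: Johnson scheme and Terwilliger algebra. $[m]=\{1,\dots,m\}$, and $\binom{[m]}{k}$ is the set of $k$-subsets of $[m]$. $\mathrm{Mat}_X(\mathbb{C})$ is the algebra of complex matrices with rows and columns indexed by $X=\binom{[2d]}{d}$. For $0\le i\le d$ let $R_i=\{(y,z)\in X\times X: |y\cap z|=d-i\}$ and let $A_i\in\mathrm{Mat}_X(\mathbb{C})$ be the $0/1$ matrix with $(y,z)$-entry $1$ iff $(y,z)\in R_i$; $J(2d,d)=(X,\{R_i\}_{i=0}^d)$. For fixed $x\in X$ let $E_i^*$ be the diagonal matrix with $(y,y)$-entry $1$ if $(x,y)\in R_i$ and $0$ otherwise. The Terwilliger algebra $\mathcal{T}$ (with respect to $x$) is the subalgebra of $\mathrm{Mat}_X(\mathbb{C})$ generated by $A_0,\dots,A_d,E_0^*,\dots,E_d^*$. Intersection matrices and idempotents. $H^r_{i,j}(v)$ is the $0/1$ matrix with rows indexed by $\binom{[v]}{i}$ and columns by $\binom{[v]}{j}$ whose $(\alpha,\beta)$-entry is $1$ iff $|\alpha\cap\beta|=r$; $H_{i,j}(v):=H^{\min(i,j)}_{i,j}(v)$. For $0\le k\le v$, let $A_1^{(v,k)}$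 be the $0/1$ matrix indexed by $\binom{[v]}{k}$ with $(\alpha,\beta)$-entry $1$ iff $|\alpha\cap\beta|=k-1$ (adjacency matrix of $J(v,k)$; it is $0$ if $k\in\{0,v\}$). $E^{(v,k)}_j$, $0\le j\le\min(k,v-k)$, denotes the primitive idempotent of the Bose–Mesner algebra of $J(v,k)$ with $A_1^{(v,k)}E^{(v,k)}_j=\big((k-j)(v-k-j)-j\big)E^{(v,k)}_j$, i.e. the orthogonal projection onto the corresponding eigenspace of $A_1^{(v,k)}$. Convention: $E^{(v,k)}_j=0$ if $j>\min(k,v-k)$. Block structure. Let $\Omega_i=\{y\in X: |x\cap y|=d-i\}$, so $X=\dot\cup_{i=0}^d\Omega_i$. Fixing bijections $x\leftrightarrow[d]$ and $[2d]\setminus x\leftrightarrow[d]$, identify $y\in\Omega_i$ with $(y\cap x,\,y\setminus x)\in\binom{[d]}{d-i}\times\binom{[d]}{i}$; thus matrices with rows indexed by $\Omega_i$ and columns by $\Omega_j$ include Kronecker products $B\otimes C$ with $B$ indexed by $\binom{[d]}{d-i}\times\binom{[d]}{d-j}$ and $C$ by $\binom{[d]}{i}\times\binom{[d]}{j}$. For $0\le i,j\le d$, $N_{i,j}$ is the complex vector space spanned by $$(E_r^{(d,d-i)}\otimes E_s^{(d,i)}+E_s^{(d,d-i)}\otimes E_r^{(d,i)})(H_{d-i,d-j}(d)\otimes H_{i,j}(d)),\quad 0\le r\le s\le\min(d,d-i).$$ For such $\Omega_i\times\Omega_j$-indexed $Y$, $L(Y)\in\mathrm{Mat}_X(\mathbb{C})$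 is the matrix whose $\Omega_i\times\Omega_j$ block is $Y$ and whose other blocks are $0$. *)

theory Defs
  imports Complex_Main "HOL-Library.Function_Algebras"
begin

text \<open>
  A complex matrix with rows indexed by a set \<open>I\<close> and columns indexed by a set \<open>J\<close> is a function of
  two arguments that vanishes outside \<open>I \<times> J\<close>. Sums of matrices are the pointwise sums of
  \<open>Function_Algebras\<close>; the pointwise product of that theory is never used.
\<close>

type_synonym ('a, 'b) cmatrix = "'a \<Rightarrow> 'b \<Rightarrow> complex"

definition mats :: "'a set \<Rightarrow> 'b set \<Rightarrow> ('a, 'b) cmatrix set" where
  "mats I J = {M. \<forall>a b. M a b \<noteq> 0 \<longrightarrow> a \<in> I \<and> b \<in> J}"

definition mscale :: "complex \<Rightarrow> ('a, 'b) cmatrix \<Rightarrow> ('a, 'b) cmatrix" where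
  "mscale c M = (\<lambda>a b. c * M a b)"

interpretation mat_space: vector_space mscale
  by unfold_locales (auto simp: mscale_def fun_eq_iff algebra_simps)

definition mmul :: "'b set \<Rightarrow> ('a, 'b) cmatrix \<Rightarrow> ('b, 'c) cmatrix \<Rightarrow> ('a, 'c) cmatrix" where
  "mmul J M N = (\<lambda>a c. \<Sum>b\<in>J. M a b * N b c)"

definition mone :: "'a set \<Rightarrow> ('a, 'a) cmatrix" where
  "mone I = (\<lambda>a b. if a \<in> I \<and> a = b then 1 else 0)"

definition kron :: "('a, 'b) cmatrix \<Rightarrow> ('c, 'd) cmatrix \<Rightarrow> ('a \<times> 'c, 'b \<times> 'd) cmatrix" where
  "kron B C = (\<lambda>(a, a') (b, b'). B a b * C a' b')"

definition is_subalgebra :: "'a set \<Rightarrow> ('a, 'a) cmatrix set \<Rightarrow> bool" where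
  "is_subalgebra I S \<longleftrightarrow>
     S \<subseteq> mats I I \<and> mat_space.subspace S \<and> mone I \<in> S \<and> (\<forall>M\<in>S. \<forall>N\<in>S. mmul I M N \<in> S)"

definition vecs :: "'a set \<Rightarrow> ('a \<Rightarrow> complex) set" where
  "vecs I = {u. \<forall>a. u a \<noteq> 0 \<longrightarrow> a \<in> I}"

definition mvec :: "'b set \<Rightarrow> ('a, 'b) cmatrix \<Rightarrow> ('b \<Rightarrow> complex) \<Rightarrow> 'a \<Rightarrow> complex" where
  "mvec J M u = (\<lambda>a. \<Sum>b\<in>J. M a b * u b)"

definition cinner :: "'a set \<Rightarrow> ('a \<Rightarrow> complex) \<Rightarrow> ('a \<Rightarrow> complex) \<Rightarrow> complex" where
  "cinner I u w = (\<Sum>a\<in>I. u a * cnj (w a))"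

definition eigspace :: "'a set \<Rightarrow> ('a, 'a) cmatrix \<Rightarrow> complex \<Rightarrow> ('a \<Rightarrow> complex) set" where
  "eigspace I A \<theta> = {u \<in> vecs I. mvec I A u = (\<lambda>a. \<theta> * u a)}"

definition orth_proj :: "'a set \<Rightarrow> ('a \<Rightarrow> complex) set \<Rightarrow> ('a, 'a) cmatrix" where
  "orth_proj I W = (THE P. P \<in> mats I I \<and>
     (\<forall>u\<in>vecs I. mvec I P u \<in> W \<and> (\<forall>w\<in>W. cinner I (u - mvec I P u) w = 0)))"

definition ksub :: "nat \<Rightarrow> nat \<Rightarrow> nat set set" where
  "ksub m k = {s. s \<subseteq> {1..m} \<and> card s = k}"


subsection \<open>The Johnson scheme \<open>J(2d,d)\<close> and its Terwilliger algebra\<close>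

definition johnson_rel :: "nat \<Rightarrow> nat \<Rightarrow> (nat set \<times> nat set) set" where
  "johnson_rel d i = {(y, z). y \<in> ksub (2 * d) d \<and> z \<in> ksub (2 * d) d \<and> card (y \<inter> z) = d - i}"

definition assoc_mat :: "nat \<Rightarrow> nat \<Rightarrow> (nat set, nat set) cmatrix" where
  "assoc_mat d i = (\<lambda>y z. if (y, z) \<in> johnson_rel d i then 1 else 0)"

definition dual_idem :: "nat \<Rightarrow> nat set \<Rightarrow> nat \<Rightarrow> (nat set, nat set) cmatrix" where
  "dual_idem d x i = (\<lambda>y z. if y = z \<and> (x, y) \<in> johnson_rel d i then 1 else 0)"

definition terwilliger :: "nat \<Rightarrow> nat set \<Rightarrow> (nat set, nat set) cmatrix set" where
  "terwilliger d x =
     is_subalgebra (ksub (2 * d) d) hull (assoc_mat d ` {0..d} \<union> dual_idem d x ` {0..d})"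


subsection \<open>Intersection matrices and primitive idempotents of \<open>J(v,k)\<close>\<close>

definition inter_mat :: "nat \<Rightarrow> nat \<Rightarrow> nat \<Rightarrow> nat \<Rightarrow> (nat set, nat set) cmatrix" where
  "inter_mat r i j v = (\<lambda>\<alpha> \<beta>. if \<alpha> \<in> ksub v i \<and> \<beta> \<in> ksub v j \<and> card (\<alpha> \<inter> \<beta>) = r then 1 else 0)"

abbreviation incl_mat :: "nat \<Rightarrow> nat \<Rightarrow> nat \<Rightarrow> (nat set, nat set) cmatrix" where
  "incl_mat i j v \<equiv> inter_mat (min i j) i j v"

text \<open>The condition \<open>|\<alpha> \<inter> \<beta>| = k - 1\<close> is written with \<open>Suc\<close>, since truncated subtraction would
  make it hold for \<open>k = 0\<close>.\<close>

definition johnson_adj :: "nat \<Rightarrow> nat \<Rightarrow> (nat set, nat set) cmatrix" where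
  "johnson_adj v k =
     (\<lambda>\<alpha> \<beta>. if \<alpha> \<in> ksub v k \<and> \<beta> \<in> ksub v k \<and> Suc (card (\<alpha> \<inter> \<beta>)) = k then 1 else 0)"

definition johnson_eig :: "nat \<Rightarrow> nat \<Rightarrow> nat \<Rightarrow> complex" where
  "johnson_eig v k j = of_int ((int k - int j) * (int v - int k - int j) - int j)"

text \<open>The primitive idempotent of the Bose-Mesner algebra of \<open>J(v,k)\<close> belonging to the \<open>j\<close>-th
  eigenvalue is the orthogonal projection onto the corresponding eigenspace of the adjacency matrix;
  by convention it is \<open>0\<close> for \<open>j\<close> out of range.\<close>

definition prim_idem :: "nat \<Rightarrow> nat \<Rightarrow> nat \<Rightarrow> (nat set, nat set) cmatrix" where
  "prim_idem v k j =
     (if j \<le> min k (v - k)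
      then orth_proj (ksub v k) (eigspace (ksub v k) (johnson_adj v k) (johnson_eig v k j))
      else 0)"


subsection \<open>The block structure\<close>

definition block :: "nat \<Rightarrow> nat set \<Rightarrow> nat \<Rightarrow> nat set set" where
  "block d x i = {y \<in> ksub (2 * d) d. card (x \<inter> y) = d - i}"

definition N_gen :: "nat \<Rightarrow> nat \<Rightarrow> nat \<Rightarrow> nat \<Rightarrow> nat \<Rightarrow>
    (nat set \<times> nat set, nat set \<times> nat set) cmatrix" where
  "N_gen d i j r s =
     mmul (ksub d (d - i) \<times> ksub d i)
       (kron (prim_idem d (d - i) r) (prim_idem d i s) + kron (prim_idem d (d - i) s) (prim_idem d i r))
       (kron (incl_mat (d - i) (d - j) d) (incl_mat i j d))"

definition N_space :: "nat \<Rightarrow> nat \<Rightarrow> nat \<Rightarrow> (nat set \<times> nat set, nat set \<times> nat set) cmatrix set" where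
  "N_space d i j = mat_space.span {N_gen d i j r s | r s. r \<le> s \<and> s \<le> min d (d - i)}"

text \<open>\<open>f\<close> and \<open>g\<close> are the bijections from \<open>x\<close> and from its complement onto \<open>{1..d}\<close>;
  \<open>embed_block\<close> is the map \<open>L\<close>, with the identification of rows and columns built in.\<close>

definition split_set :: "nat set \<Rightarrow> (nat \<Rightarrow> nat) \<Rightarrow> (nat \<Rightarrow> nat) \<Rightarrow> nat set \<Rightarrow> nat set \<times> nat set" where
  "split_set x f g y = (f ` (y \<inter> x), g ` (y - x))"

definition embed_block :: "nat \<Rightarrow> nat set \<Rightarrow> (nat \<Rightarrow> nat) \<Rightarrow> (nat \<Rightarrow> nat) \<Rightarrow> nat \<Rightarrow> nat \<Rightarrow>
    (nat set \<times> nat set, nat set \<times> nat set) cmatrix \<Rightarrow> (nat set, nat set) cmatrix" where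
  "embed_block d x f g i j Y =
     (\<lambda>y z. if y \<in> block d x i \<and> z \<in> block d x j
            then Y (split_set x f g y) (split_set x f g z) else 0)"

definition N_total :: "nat \<Rightarrow> nat set \<Rightarrow> (nat \<Rightarrow> nat) \<Rightarrow> (nat \<Rightarrow> nat) \<Rightarrow> (nat set, nat set) cmatrix set" where
  "N_total d x f g =
     {(\<Sum>i\<le>d. \<Sum>j\<le>d. embed_block d x f g i j (Y i j)) | Y. \<forall>i\<le>d. \<forall>j\<le>d. Y i j \<in> N_space d i j}"

text \<open>The sum in \<open>N_total\<close> is direct.\<close>

lemma N_total_direct:
  assumes eq: "(\<Sum>i\<le>d. \<Sum>j\<le>d. embed_block d x f g i j (Y i j)) =
               (\<Sum>i\<le>d. \<Sum>j\<le>d. embed_block d x f g i j (Z i j))"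
    and ij: "i \<le> d" "j \<le> d"
  shows "embed_block d x f g i j (Y i j) = embed_block d x f g i j (Z i j)"
proof (intro ext)
  fix y z
  have app: "(\<Sum>a\<in>A. F a) u v = (\<Sum>a\<in>A. F a u v)"
    for F :: "nat \<Rightarrow> (nat set, nat set) cmatrix" and A u v
    by (induction A rule: infinite_finite_induct) auto
  have blk: "(\<Sum>a\<le>d. \<Sum>b\<le>d. embed_block d x f g a b (W a b)) y z = embed_block d x f g i j (W i j) y z"
    if y: "y \<in> block d x i" and z: "z \<in> block d x j" for W
  proof -
    let ?c = "embed_block d x f g i j (W i j) y z"
    have entry: "embed_block d x f g a b (W a b) y z = (if a = i then if b = j then ?c else 0 else 0)"
      if ab: "a \<le> d" "b \<le> d" for a b
    proof (cases "a = i \<and> b = j")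
      case False
      have "a = i" if "y \<in> block d x a"
        using that y ab ij unfolding block_def by simp
      moreover have "b = j" if "z \<in> block d x b"
        using that z ab ij unfolding block_def by simp
      ultimately have "\<not> (y \<in> block d x a \<and> z \<in> block d x b)"
        using False by blast
      then have "embed_block d x f g a b (W a b) y z = 0"
        by (simp only: embed_block_def if_False)
      also have "0 = (if a = i then if b = j then ?c else 0 else 0)"
        using False by presburger
      finally show ?thesis .
    qed simp
    have "(\<Sum>a\<le>d. \<Sum>b\<le>d. embed_block d x f g a b (W a b)) y z =
        (\<Sum>a\<le>d. \<Sum>b\<le>d. embed_block d x f g a b (W a b) y z)"
      by (simp only: app)
    also have "\<dots> = (\<Sum>a\<le>d. \<Sum>b\<le>d. if a = i then if b = j then ?c else 0 else 0)"
      by (intro sum.cong refl entry) auto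
    also have "\<dots> = (\<Sum>a\<le>d. if a = i then \<Sum>b\<le>d. if b = j then ?c else 0 else 0)"
      by (intro sum.cong refl) simp
    also have "\<dots> = ?c"
      using ij by (simp only: sum.delta finite_atMost atMost_iff if_True)
    finally show ?thesis .
  qed
  show "embed_block d x f g i j (Y i j) y z = embed_block d x f g i j (Z i j) y z"
  proof (cases "y \<in> block d x i \<and> z \<in> block d x j")
    case True
    then show ?thesis using blk[of Y] blk[of Z] by (simp only: eq)
  next
    case False
    then show ?thesis unfolding embed_block_def by meson
  qed
qed

end

theory Submission
  imports Defs "HOL-Computational_Algebra.Polynomial"
begin

text \<open>
  A vertex \<open>y\<close> in the \<open>i\<close>-th subconstituent of \<open>x\<close> is encoded by the pair
  \<open>(a, b) = (f ` (x - y), g ` (y - x))\<close> of \<open>i\<close>-subsets of \<open>{1..d}\<close>. If \<open>z\<close> in the \<open>j\<close>-th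
  subconstituent has coordinates \<open>(a', b')\<close>, then \<open>|y \<inter> z| = d - i - j + |a \<inter> a'| + |b \<inter> b'|\<close>.
  Passing from \<open>y \<inter> x\<close> to \<open>x - y\<close> is complementation in the first factor, which carries
  \<open>E\<^sub>r\<close> of \<open>J(d,d-i)\<close> to \<open>E\<^sub>r\<close> of \<open>J(d,i)\<close> and preserves inclusion matrices; the generators of
  \<open>N_space d i j\<close> become the symmetrised products \<open>E\<^sub>r H \<otimes> E\<^sub>s H + E\<^sub>s H \<otimes> E\<^sub>r H\<close>, where \<open>H\<close> is the
  inclusion matrix between \<open>i\<close>-sets and \<open>j\<close>-sets.

  The Terwilliger algebra is contained in the block space. The permutations of the two copies of
  \<open>{1..d}\<close>, together with the exchange of the copies, preserve all generators. The orbit of a pair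
  of vertices is determined by \<open>i\<close>, \<open>j\<close> and the unordered pair of intersection sizes
  (\<open>orb_type_transfer\<close>), so the matrices depending only on these data form an algebra
  (\<open>orbit_algebra_mmul\<close>). Such a matrix is a combination of
  \<open>H\<^sup>p \<otimes> H\<^sup>q + H\<^sup>q \<otimes> H\<^sup>p\<close>, with \<open>H\<^sup>p\<close> the matrix of intersection size \<open>p\<close>, and every \<open>H\<^sup>p\<close> is
  a combination of the \<open>E\<^sub>r H\<close> (\<open>inter_mat_expand\<close>): the adjacency matrix \<open>A\<close> of \<open>J(d,i)\<close> acts
  tridiagonally on the \<open>H\<^sup>p\<close> (\<open>adj_mult_inter\<close>), hence each \<open>H\<^sup>p\<close> is a polynomial in \<open>A\<close> times \<open>H\<close>,
  and the idempotents \<open>E\<^sub>r\<close> span the polynomials in \<open>A\<close> (\<open>mat_poly_spectral\<close>).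

  Conversely, the block of \<open>A\<^sub>k\<close> between two subconstituents is \<open>\<Sum> H\<^sup>p \<otimes> H\<^sup>q\<close> over
  \<open>p + q = i + j - k\<close>. For \<open>i = j\<close> and \<open>k = 1, 2\<close> these blocks generate all symmetric polynomials in
  \<open>A \<otimes> 1\<close> and \<open>1 \<otimes> A\<close> (\<open>symmetric_poly_generated\<close>), in particular
  \<open>E\<^sub>r \<otimes> E\<^sub>s + E\<^sub>s \<otimes> E\<^sub>r\<close>; for \<open>k = |i - j|\<close> the block is \<open>H \<otimes> H\<close>. The products of the two are the
  spanning elements of the block space.

  The spectral theory rests on the identity \<open>(A - \<theta>\<^sub>l) H\<^sub>k\<^sub>,\<^sub>l = (k - l + 1) H\<^sub>k\<^sub>,\<^sub>l\<^sub>-\<^sub>1 H\<^sub>l\<^sub>-\<^sub>1\<^sub>,\<^sub>l\<close> for the inclusion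
  matrices (\<open>adj_mult_incl_Suc\<close>), which shows that the product of the \<open>A - \<theta>\<^sub>l\<close> vanishes.
\<close>

section \<open>Matrices indexed by finite sets\<close>

lemma matsI: "(\<And>a b. M a b \<noteq> 0 \<Longrightarrow> a \<in> I \<and> b \<in> J) \<Longrightarrow> M \<in> mats I J"
  unfolding mats_def by blast

lemma matsD: "M \<in> mats I J \<Longrightarrow> a \<notin> I \<or> b \<notin> J \<Longrightarrow> M a b = 0"
  unfolding mats_def by blast

lemma sum_mat_apply: "(\<Sum>a\<in>A. F a) u v = (\<Sum>a\<in>A. (F a u v :: complex))"
  by (induction A rule: infinite_finite_induct) auto

lemma mats_eqI:
  assumes "M \<in> mats I J" "N \<in> mats I J" "\<And>a b. a \<in> I \<Longrightarrow> b \<in> J \<Longrightarrow> M a b = N a b"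
  shows "M = N"
proof (intro ext)
  fix a b show "M a b = N a b"
    using assms matsD[OF assms(1), of a b] matsD[OF assms(2), of a b] by (cases "a \<in> I \<and> b \<in> J") auto
qed

lemma mats_add: "M \<in> mats I J \<Longrightarrow> N \<in> mats I J \<Longrightarrow> M + N \<in> mats I J"
  unfolding mats_def by (auto simp: plus_fun_apply) (metis add_0)+

lemma mats_mscale: "M \<in> mats I J \<Longrightarrow> mscale c M \<in> mats I J"
  unfolding mats_def mscale_def by force

lemma mats_zero: "0 \<in> mats I J"
  unfolding mats_def by simp

lemma mats_sum: "(\<And>a. a \<in> A \<Longrightarrow> F a \<in> mats I J) \<Longrightarrow> (\<Sum>a\<in>A. F a) \<in> mats I J"
  by (induction A rule: infinite_finite_induct) (auto simp: mats_zero mats_add)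

lemma mats_mone: "mone I \<in> mats I I"
  unfolding mats_def mone_def by simp

lemma mats_mmul: "M \<in> mats I J \<Longrightarrow> N \<in> mats J' K \<Longrightarrow> mmul L M N \<in> mats I K"
proof (rule matsI)
  fix a b assume M: "M \<in> mats I J" and N: "N \<in> mats J' K" and "mmul L M N a b \<noteq> 0"
  then obtain c where "M a c * N c b \<noteq> 0"
    unfolding mmul_def by (meson sum.not_neutral_contains_not_neutral)
  then show "a \<in> I \<and> b \<in> K"
    using M N unfolding mats_def by auto
qed

lemma mats_kron: "M \<in> mats I J \<Longrightarrow> N \<in> mats K L \<Longrightarrow> kron M N \<in> mats (I \<times> K) (J \<times> L)"
  unfolding mats_def kron_def by force

lemma mscale_apply: "mscale c M a b = c * M a b"
  by (simp add: mscale_def)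

lemma mmul_assoc: "mmul J M (mmul K N P) = mmul K (mmul J M N) P"
proof (intro ext)
  fix a c
  have "(\<Sum>b\<in>J. \<Sum>e\<in>K. M a b * (N b e * P e c)) = (\<Sum>e\<in>K. \<Sum>b\<in>J. M a b * (N b e * P e c))"
    by (rule sum.swap)
  then show "mmul J M (mmul K N P) a c = mmul K (mmul J M N) P a c"
    unfolding mmul_def by (simp add: sum_distrib_left sum_distrib_right mult.assoc)
qed

lemma mmul_add_left: "mmul J (M + M') N = mmul J M N + mmul J M' N"
  unfolding mmul_def by (simp add: fun_eq_iff algebra_simps sum.distrib)

lemma mmul_add_right: "mmul J M (N + N') = mmul J M N + mmul J M N'"
  unfolding mmul_def by (simp add: fun_eq_iff algebra_simps sum.distrib)

lemma mmul_mscale_left: "mmul J (mscale c M) N = mscale c (mmul J M N)"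
  unfolding mmul_def mscale_def by (simp add: fun_eq_iff sum_distrib_left mult.assoc)

lemma mmul_mscale_right: "mmul J M (mscale c N) = mscale c (mmul J M N)"
  unfolding mmul_def mscale_def by (simp add: fun_eq_iff sum_distrib_left algebra_simps)

lemma mmul_zero_left: "mmul J 0 N = 0"
  unfolding mmul_def by (simp add: fun_eq_iff)

lemma mmul_zero_right: "mmul J M 0 = 0"
  unfolding mmul_def by (simp add: fun_eq_iff)

(* The pointwise rules for 0 and + are switched off in inductions on sums of matrices: they would
   unfold these sums under the two lambda abstractions. *)
lemma mmul_sum_left: "mmul J (\<Sum>a\<in>A. F a) N = (\<Sum>a\<in>A. mmul J (F a) N)"
  by (induction A rule: infinite_finite_induct) (auto simp: mmul_zero_left mmul_add_left simp del: zero_fun_apply plus_fun_apply)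

lemma mmul_mone_left: "finite I \<Longrightarrow> M \<in> mats I J \<Longrightarrow> mmul I (mone I) M = M"
proof (intro ext)
  fix a b assume I: "finite I" and M: "M \<in> mats I J"
  have "mmul I (mone I) M a b = (\<Sum>c\<in>I. if a = c then M c b else 0)"
    unfolding mmul_def mone_def by (intro sum.cong) auto
  also have "\<dots> = M a b"
    using I M by (auto simp: matsD)
  finally show "mmul I (mone I) M a b = M a b" .
qed

lemma mmul_mone_right: "finite J \<Longrightarrow> M \<in> mats I J \<Longrightarrow> mmul J M (mone J) = M"
proof (intro ext)
  fix a b assume J: "finite J" and M: "M \<in> mats I J"
  have "mmul J M (mone J) a b = (\<Sum>c\<in>J. if c = b then M a c else 0)"
    unfolding mmul_def mone_def by (intro sum.cong) auto
  also have "\<dots> = M a b"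
    using J M by (auto simp: matsD)
  finally show "mmul J M (mone J) a b = M a b" .
qed

lemma kron_sum_sum:
  "kron (\<Sum>a\<in>A. mscale (c a) (F a)) (\<Sum>b\<in>B. mscale (e b) (G b))
     = (\<Sum>a\<in>A. \<Sum>b\<in>B. mscale (c a * e b) (kron (F a) (G b)))"
  by (auto simp: fun_eq_iff kron_def sum_mat_apply mscale_def sum_product mult_ac)

lemma mmul_kron:
  fixes M :: "('a, 'c) cmatrix" and N :: "('b, 'd) cmatrix"
    and P :: "('c, 'e) cmatrix" and Q :: "('d, 'f) cmatrix"
  shows "mmul (I \<times> J) (kron M N) (kron P Q) = kron (mmul I M P) (mmul J N Q)"
proof (intro ext)
  fix s :: "'a \<times> 'b" and t :: "'e \<times> 'f"
  obtain a b where s: "s = (a, b)" by (cases s)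
  obtain a' b' where t: "t = (a', b')" by (cases t)
  have "mmul (I \<times> J) (kron M N) (kron P Q) s t
      = (\<Sum>(c, e)\<in>I \<times> J. (M a c * P c a') * (N b e * Q e b'))"
    unfolding mmul_def s t kron_def by (intro sum.cong) auto
  also have "\<dots> = (\<Sum>c\<in>I. M a c * P c a') * (\<Sum>e\<in>J. N b e * Q e b')"
    by (simp add: sum.cartesian_product[symmetric] sum_product)
  finally show "mmul (I \<times> J) (kron M N) (kron P Q) s t = kron (mmul I M P) (mmul J N Q) s t"
    unfolding s t kron_def mmul_def by simp
qed


section \<open>Polynomials in a matrix\<close>

primrec mat_pow :: "'a set \<Rightarrow> ('a, 'a) cmatrix \<Rightarrow> nat \<Rightarrow> ('a, 'a) cmatrix" where
  "mat_pow I A 0 = mone I"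
| "mat_pow I A (Suc n) = mmul I A (mat_pow I A n)"

text \<open>The value \<open>p(A)\<close> of a polynomial at a square matrix indexed by \<open>I\<close>.\<close>

definition mat_poly :: "'a set \<Rightarrow> ('a, 'a) cmatrix \<Rightarrow> complex poly \<Rightarrow> ('a, 'a) cmatrix" where
  "mat_poly I A p = (\<Sum>n\<le>degree p. mscale (coeff p n) (mat_pow I A n))"

lemma mats_mat_pow: "A \<in> mats I I \<Longrightarrow> mat_pow I A n \<in> mats I I"
  by (induction n) (auto intro: mats_mone mats_mmul)

lemma mats_mat_poly: "A \<in> mats I I \<Longrightarrow> mat_poly I A p \<in> mats I I"
  unfolding mat_poly_def by (intro mats_sum mats_mscale mats_mat_pow)

lemma mat_poly_bound:
  assumes "degree p \<le> N"
  shows "mat_poly I A p = (\<Sum>n\<le>N. mscale (coeff p n) (mat_pow I A n))"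
  unfolding mat_poly_def
  by (rule sum.mono_neutral_left) (use assms in \<open>auto simp: coeff_eq_0 mscale_def fun_eq_iff\<close>)

lemma mat_poly_add: "mat_poly I A (p + q) = mat_poly I A p + mat_poly I A q"
proof -
  let ?N = "max (degree p) (degree q)"
  show ?thesis
    unfolding mat_poly_bound[OF degree_add_le_max] mat_poly_bound[OF max.cobounded1[of "degree p" "degree q"]]
      mat_poly_bound[OF max.cobounded2[of "degree q" "degree p"]]
    by (simp add: mat_space.scale_left_distrib sum.distrib)
qed

lemma mat_poly_0: "mat_poly I A 0 = 0"
  unfolding mat_poly_def by (simp add: mscale_def fun_eq_iff)

lemma mat_poly_smult: "mat_poly I A (smult c p) = mscale c (mat_poly I A p)"
  unfolding mat_poly_bound[OF degree_smult_le] mat_poly_def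
  by (simp add: mat_space.scale_sum_right)

lemma mat_poly_sum: "mat_poly I A (\<Sum>a\<in>S. F a) = (\<Sum>a\<in>S. mat_poly I A (F a))"
  by (induction S rule: infinite_finite_induct) (auto simp: mat_poly_0 mat_poly_add simp del: zero_fun_apply plus_fun_apply)

lemma mat_poly_pCons: "mat_poly I A (pCons c p) = mscale c (mone I) + mmul I A (mat_poly I A p)"
proof -
  have "degree (pCons c p) \<le> Suc (degree p)" by (rule degree_pCons_le)
  then have "mat_poly I A (pCons c p)
      = (\<Sum>n\<le>Suc (degree p). mscale (coeff (pCons c p) n) (mat_pow I A n))"
    by (rule mat_poly_bound)
  also have "\<dots> = mscale c (mone I) + (\<Sum>n\<le>degree p. mscale (coeff p n) (mmul I A (mat_pow I A n)))"
    by (subst sum.atMost_Suc_shift) simp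
  also have "(\<Sum>n\<le>degree p. mscale (coeff p n) (mmul I A (mat_pow I A n))) = mmul I A (mat_poly I A p)"
    unfolding mat_poly_def mmul_def mscale_def
    by (simp add: fun_eq_iff sum_mat_apply sum_distrib_left algebra_simps) (intro allI sum.swap)
  finally show ?thesis .
qed

lemma mat_poly_mult:
  assumes "finite I" "A \<in> mats I I"
  shows "mat_poly I A (p * q) = mmul I (mat_poly I A p) (mat_poly I A q)"
proof (induction p)
  case 0
  then show ?case by (simp add: mat_poly_0 mmul_zero_left del: zero_fun_apply)
next
  case (pCons c p)
  have "mat_poly I A (pCons c p * q) = mscale c (mat_poly I A q) + mmul I A (mat_poly I A (p * q))"
    by (simp add: mat_poly_add mat_poly_smult mat_poly_pCons mult_pCons_left)
  also have "\<dots> = mmul I (mat_poly I A (pCons c p)) (mat_poly I A q)"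
    using assms
    by (simp add: pCons mat_poly_pCons mmul_add_left mmul_mscale_left mmul_mone_left[OF _ mats_mat_poly]
        mmul_assoc)
  finally show ?case .
qed

lemma mat_poly_1: "mat_poly I A 1 = mone I"
  unfolding mat_poly_def by simp

lemma mat_poly_linear:
  assumes "finite I" "A \<in> mats I I"
  shows "mat_poly I A [:c, 1:] = mscale c (mone I) + A"
  using assms mmul_mone_right[of I A I]
  by (simp add: mat_poly_pCons mat_poly_0 mmul_zero_right mmul_mscale_right)

lemma mat_poly_X:
  assumes "finite I" "A \<in> mats I I"
  shows "mat_poly I A [:0, 1:] = A"
  using mat_poly_linear[OF assms, of 0] by simp

lemma mat_pow_transport:
  assumes c: "bij_betw c I I'" and A: "\<And>a b. a \<in> I \<Longrightarrow> b \<in> I \<Longrightarrow> A' (c a) (c b) = A a b"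
    and ab: "a \<in> I" "b \<in> I"
  shows "mat_pow I' A' n (c a) (c b) = mat_pow I A n a b"
  using ab
proof (induction n arbitrary: a b)
  case 0
  then show ?case
    using c by (auto simp: mone_def bij_betw_def inj_on_def)
next
  case (Suc n)
  have "mat_pow I' A' (Suc n) (c a) (c b) = (\<Sum>e\<in>I. A' (c a) (c e) * mat_pow I' A' n (c e) (c b))"
    by (simp add: mmul_def sum.reindex_bij_betw[OF c, symmetric])
  also have "\<dots> = mat_pow I A (Suc n) a b"
    using Suc A by (simp add: mmul_def)
  finally show ?case .
qed

lemma mat_poly_transport:
  assumes c: "bij_betw c I I'" and A: "\<And>a b. a \<in> I \<Longrightarrow> b \<in> I \<Longrightarrow> A' (c a) (c b) = A a b"
    and ab: "a \<in> I" "b \<in> I"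
  shows "mat_poly I' A' p (c a) (c b) = mat_poly I A p a b"
  unfolding mat_poly_def by (simp add: sum_mat_apply mscale_apply mat_pow_transport[of c I I' A' A a b, OF c A ab])

section \<open>Neighbour counts in the Johnson graph\<close>

lemma finite_ksub: "finite (ksub v k)"
  by (rule finite_subset[of _ "Pow {1..v}"]) (auto simp: ksub_def)

lemma ksub_finite: "a \<in> ksub v k \<Longrightarrow> finite a"
  by (auto simp: ksub_def intro: finite_subset)

lemma card_Int_le: "a \<in> ksub v i \<Longrightarrow> card (a \<inter> b) \<le> i"
  using ksub_finite[of a v i] card_mono[of a "a \<inter> b"] by (auto simp: ksub_def)

lemma card_Int_le': "b \<in> ksub v j \<Longrightarrow> card (a \<inter> b) \<le> j"
  using card_Int_le[of b v j a] by (simp add: Int_commute)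

lemma card_Un_ksub:
  assumes "a \<in> ksub v i" "b \<in> ksub v j"
  shows "card (a \<union> b) + card (a \<inter> b) = i + j"
  using card_Un_Int[of a b] ksub_finite[OF assms(1)] ksub_finite[OF assms(2)] assms
  by (simp add: ksub_def)

lemma mats_inter: "inter_mat r i j v \<in> mats (ksub v i) (ksub v j)"
  by (auto simp: mats_def inter_mat_def)

lemma mats_adj: "johnson_adj v k \<in> mats (ksub v k) (ksub v k)"
  by (auto simp: mats_def johnson_adj_def)

text \<open>The neighbours of \<open>a\<close> in \<open>J(v,i)\<close> are the sets \<open>a - {u} \<union> {w}\<close>.\<close>

lemma johnson_nbr_bij:
  assumes a: "a \<in> ksub v i"
  shows "bij_betw (\<lambda>(u, w). insert w (a - {u})) (a \<times> ({1..v} - a))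
           {c \<in> ksub v i. Suc (card (a \<inter> c)) = i}"
proof -
  have fa: "finite a" and sa: "a \<subseteq> {1..v}" and ca: "card a = i"
    using a ksub_finite[OF a] by (simp_all add: ksub_def)
  have 1: "insert w (a - {u}) \<in> {c \<in> ksub v i. Suc (card (a \<inter> c)) = i}"
    if "u \<in> a" "w \<in> {1..v} - a" for u w
  proof -
    have del: "Suc (card (a - {u})) = i" using card_Suc_Diff1[OF fa that(1)] ca by (rule trans)
    have "a \<inter> insert w (a - {u}) = a - {u}" using that by blast
    moreover have "card (insert w (a - {u})) = Suc (card (a - {u}))" using that fa by simp
    moreover have "insert w (a - {u}) \<subseteq> {1..v}" using that sa by blast
    ultimately show ?thesis using del unfolding ksub_def by (intro CollectI conjI) metis+
  qed
  have 2: "c \<in> (\<lambda>(u, w). insert w (a - {u})) ` (a \<times> ({1..v} - a))"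
    if c: "c \<in> ksub v i" "Suc (card (a \<inter> c)) = i" for c
  proof -
    have fc: "finite c" and cc: "card c = i" and sc: "c \<subseteq> {1..v}"
      using c(1) ksub_finite[OF c(1)] by (simp_all add: ksub_def)
    have "card (a - c) = card a - card (a \<inter> c)" "card (c - a) = card c - card (a \<inter> c)"
      using card_Diff_subset_Int[of a c] card_Diff_subset_Int[of c a] fa fc Int_commute[of c a] by simp_all
    then have "card (a - c) = 1" "card (c - a) = 1"
      using ca cc c(2) by linarith+
    then obtain u w where "a - c = {u}" "c - a = {w}" by (auto simp: card_1_singleton_iff)
    then have "c = insert w (a - {u})" "u \<in> a" "w \<in> {1..v} - a" using sc by auto
    then show ?thesis by force
  qed
  have 3: "inj_on (\<lambda>(u, w). insert w (a - {u})) (a \<times> ({1..v} - a))"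
  proof (rule inj_onI, clarsimp)
    fix u w u' w' assume *: "u \<in> a" "u' \<in> a" "w \<notin> a" "w' \<notin> a"
      and eq: "insert w (a - {u}) = insert w' (a - {u'})"
    have "a - insert w (a - {u}) = {u}" "a - insert w' (a - {u'}) = {u'}"
      "insert w (a - {u}) - a = {w}" "insert w' (a - {u'}) - a = {w'}"
      using * by auto
    then show "u = u' \<and> w = w'" using eq by simp
  qed
  have "(\<lambda>(u, w). insert w (a - {u})) ` (a \<times> ({1..v} - a)) \<subseteq> {c \<in> ksub v i. Suc (card (a \<inter> c)) = i}"
  proof (rule image_subsetI)
    fix p assume "p \<in> a \<times> ({1..v} - a)"
    then obtain u w where "p = (u, w)" "u \<in> a" "w \<in> {1..v} - a" by blast
    then show "(case p of (u, w) \<Rightarrow> insert w (a - {u})) \<in> {c \<in> ksub v i. Suc (card (a \<inter> c)) = i}"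
      using 1[of u w] by (simp only: prod.case)
  qed
  moreover have "{c \<in> ksub v i. Suc (card (a \<inter> c)) = i} \<subseteq> (\<lambda>(u, w). insert w (a - {u})) ` (a \<times> ({1..v} - a))"
    using 2 by (intro subsetI) (simp only: mem_Collect_eq)
  ultimately show ?thesis unfolding bij_betw_def using 3 by (intro conjI equalityI)
qed

lemma johnson_nbr_sum:
  fixes F :: "nat \<Rightarrow> complex"
  assumes a: "a \<in> ksub v i" and b: "b \<in> ksub v j"
  defines "q \<equiv> card (a \<inter> b)"
  shows "(\<Sum>c | c \<in> ksub v i \<and> Suc (card (a \<inter> c)) = i. F (card (c \<inter> b)))
     = of_nat (i - q) * of_nat (j - q) * F (Suc q)
     + (of_nat q * of_nat (j - q) + of_nat (i - q) * of_nat (v - (i + j - q))) * F q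
     + of_nat q * of_nat (v - (i + j - q)) * F (q - 1)"
proof -
  have fa: "finite a" and sa: "a \<subseteq> {1..v}" and ca: "card a = i"
    using a ksub_finite[OF a] by (simp_all add: ksub_def)
  have fb: "finite b" and sb: "b \<subseteq> {1..v}" and cb: "card b = j"
    using b ksub_finite[OF b] by (simp_all add: ksub_def)
  have cards: "card (a \<inter> {u. u \<in> b}) = q" "card (a \<inter> - {u. u \<in> b}) = i - q"
    "card (({1..v} - a) \<inter> {w. w \<in> b}) = j - q"
    "card (({1..v} - a) \<inter> - {w. w \<in> b}) = v - (i + j - q)"
  proof -
    show "card (a \<inter> {u. u \<in> b}) = q" by (simp add: q_def)
    have "a \<inter> - {u. u \<in> b} = a - b" by auto
    then show "card (a \<inter> - {u. u \<in> b}) = i - q"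
      using card_Diff_subset_Int[of a b] fa by (simp add: q_def ca)
    have "({1..v} - a) \<inter> {w. w \<in> b} = b - a" using sb by auto
    then show "card (({1..v} - a) \<inter> {w. w \<in> b}) = j - q"
      using card_Diff_subset_Int[of b a] fb Int_commute[of b a] by (simp add: q_def cb)
    have "({1..v} - a) \<inter> - {w. w \<in> b} = {1..v} - (a \<union> b)" by auto
    then show "card (({1..v} - a) \<inter> - {w. w \<in> b}) = v - (i + j - q)"
      using card_Diff_subset[of "a \<union> b" "{1..v}"] fa fb sa sb card_Un_ksub[OF a b]
      by (simp add: q_def)
  qed
  have step: "F (card (insert w (a - {u}) \<inter> b))
      = (if u \<in> b then (if w \<in> b then F q else F (q - 1)) else (if w \<in> b then F (Suc q) else F q))"
    if "u \<in> a" "w \<in> {1..v} - a" for u w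
  proof -
    have "insert w (a - {u}) \<inter> b
        = (if u \<in> b then (if w \<in> b then insert w (a \<inter> b - {u}) else a \<inter> b - {u})
           else (if w \<in> b then insert w (a \<inter> b) else a \<inter> b))"
      using that by auto
    moreover have "u \<in> b \<Longrightarrow> q > 0" using that fa by (auto simp: q_def card_gt_0_iff)
    ultimately show ?thesis using that fa by (auto simp: q_def)
  qed
  have "(\<Sum>c | c \<in> ksub v i \<and> Suc (card (a \<inter> c)) = i. F (card (c \<inter> b)))
      = (\<Sum>(u, w)\<in>a \<times> ({1..v} - a). F (card (insert w (a - {u}) \<inter> b)))"
    using sum.reindex_bij_betw[OF johnson_nbr_bij[OF a], of "\<lambda>c. F (card (c \<inter> b))"]
    by (simp add: case_prod_unfold)
  also have "\<dots> = (\<Sum>u\<in>a. \<Sum>w\<in>{1..v} - a.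
      if u \<in> b then (if w \<in> b then F q else F (q - 1)) else (if w \<in> b then F (Suc q) else F q))"
    unfolding sum.cartesian_product[symmetric] by (intro sum.cong refl step)
  also have "\<dots> = (\<Sum>u\<in>a. if u \<in> b
        then of_nat (j - q) * F q + of_nat (v - (i + j - q)) * F (q - 1)
        else of_nat (j - q) * F (Suc q) + of_nat (v - (i + j - q)) * F q)"
    by (intro sum.cong refl) (simp add: sum.If_cases cards[simplified])
  also have "\<dots> = of_nat q * (of_nat (j - q) * F q + of_nat (v - (i + j - q)) * F (q - 1))
      + of_nat (i - q) * (of_nat (j - q) * F (Suc q) + of_nat (v - (i + j - q)) * F q)"
    by (simp add: sum.If_cases fa cards[simplified])
  finally show ?thesis by (simp add: algebra_simps)
qed

lemma mmul_adj:
  "mmul (ksub v i) (johnson_adj v i) M a b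
     = (if a \<in> ksub v i then \<Sum>c | c \<in> ksub v i \<and> Suc (card (a \<inter> c)) = i. M c b else 0)"
proof (cases "a \<in> ksub v i")
  case True
  have "mmul (ksub v i) (johnson_adj v i) M a b
      = (\<Sum>c\<in>ksub v i. if Suc (card (a \<inter> c)) = i then M c b else 0)"
    unfolding mmul_def using True by (intro sum.cong) (auto simp: johnson_adj_def)
  also have "\<dots> = (\<Sum>c | c \<in> ksub v i \<and> Suc (card (a \<inter> c)) = i. M c b)"
    by (rule sum.inter_filter[OF finite_ksub, symmetric])
  finally show ?thesis using True by simp
qed (simp add: mmul_def johnson_adj_def)

text \<open>Multiplication by the adjacency matrix acts tridiagonally on the intersection matrices
  \<open>H\<^sup>p\<close>.\<close>

lemma adj_mult_inter:
  "mmul (ksub v i) (johnson_adj v i) (inter_mat p i j v)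
     = mscale (of_nat (Suc p) * of_nat (v - (i + j - Suc p))) (inter_mat (Suc p) i j v)
     + mscale (of_nat p * of_nat (j - p) + of_nat (i - p) * of_nat (v - (i + j - p))) (inter_mat p i j v)
     + (if p = 0 then 0
        else mscale (of_nat (i - (p - 1)) * of_nat (j - (p - 1))) (inter_mat (p - 1) i j v))"
  (is "?L = ?R")
proof (rule mats_eqI)
  show "?L \<in> mats (ksub v i) (ksub v j)"
    by (rule mats_mmul[OF mats_adj mats_inter])
  show "?R \<in> mats (ksub v i) (ksub v j)"
    by (auto intro!: mats_add mats_mscale mats_inter mats_zero)
next
  fix a b assume ab: "a \<in> ksub v i" "b \<in> ksub v j"
  let ?q = "card (a \<inter> b)"
  have "?L a b = (\<Sum>c | c \<in> ksub v i \<and> Suc (card (a \<inter> c)) = i. if card (c \<inter> b) = p then 1 else 0)"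
    unfolding mmul_adj using ab by (auto simp: inter_mat_def intro!: sum.cong)
  also have "\<dots> = of_nat (i - ?q) * of_nat (j - ?q) * (if Suc ?q = p then 1 else 0)
     + (of_nat ?q * of_nat (j - ?q) + of_nat (i - ?q) * of_nat (v - (i + j - ?q))) * (if ?q = p then 1 else 0)
     + of_nat ?q * of_nat (v - (i + j - ?q)) * (if ?q - 1 = p then 1 else 0)"
    by (rule johnson_nbr_sum[OF ab, of "\<lambda>t. if t = p then 1 else 0"])
  also have "\<dots> = ?R a b"
  proof -
    consider "?q = Suc p" | "?q = p" | "Suc ?q = p" | "?q \<noteq> Suc p" "?q \<noteq> p" "Suc ?q \<noteq> p" by blast
    then show ?thesis
    proof cases
      case 4
      then have "?q \<noteq> p - 1 \<or> p = 0" by linarith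
      moreover have "of_nat ?q * (if ?q - 1 = p then 1 else 0) = (0 :: complex)"
        using 4 by (cases ?q) auto
      ultimately show ?thesis using 4 ab by (auto simp: inter_mat_def mscale_def)
    qed (use ab in \<open>auto simp: inter_mat_def mscale_def\<close>)
  qed
  finally show "?L a b = ?R a b" .
qed

lemma inter_mat_eq_0:
  assumes "r > min i j"
  shows "inter_mat r i j v = 0"
proof -
  have "card (a \<inter> b) \<noteq> r" if "a \<in> ksub v i" "b \<in> ksub v j" for a b
    using card_Int_le[OF that(1), of b] card_Int_le'[OF that(2), of a] assms by auto
  then show ?thesis by (auto simp: inter_mat_def fun_eq_iff)
qed

lemma inter_mat_mone: "inter_mat k k k v = mone (ksub v k)"
proof -
  have "a = b" if ab: "a \<in> ksub v k" "b \<in> ksub v k" "card (a \<inter> b) = k" for a b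
  proof -
    have "a \<inter> b = a" "a \<inter> b = b"
      using ab ksub_finite[OF ab(1)] ksub_finite[OF ab(2)]
      by (intro card_subset_eq; auto simp: ksub_def)+
    then show ?thesis by auto
  qed
  then show ?thesis by (auto simp: inter_mat_def mone_def fun_eq_iff ksub_def)
qed

lemma inter_mat_adj: "inter_mat k (Suc k) (Suc k) v = johnson_adj v (Suc k)"
  by (auto simp: inter_mat_def johnson_adj_def fun_eq_iff)

lemma incl_mult_incl:
  assumes "l < k"
  shows "mmul (ksub v l) (inter_mat l k l v) (inter_mat l l (Suc l) v)
     = mscale (of_nat (Suc l)) (inter_mat (Suc l) k (Suc l) v) + inter_mat l k (Suc l) v"
  (is "?L = ?R")
proof (rule mats_eqI)
  show "?L \<in> mats (ksub v k) (ksub v (Suc l))"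
    by (rule mats_mmul[OF mats_inter mats_inter])
  show "?R \<in> mats (ksub v k) (ksub v (Suc l))"
    by (intro mats_add mats_mscale mats_inter)
next
  fix a b assume ab: "a \<in> ksub v k" "b \<in> ksub v (Suc l)"
  have fin: "finite (a \<inter> b)" using ksub_finite[OF ab(1)] by simp
  have sub: "card (a \<inter> c) = l \<longleftrightarrow> c \<subseteq> a" "card (c \<inter> b) = l \<longleftrightarrow> c \<subseteq> b" if c: "c \<in> ksub v l" for c
  proof -
    have fc: "finite c" "card c = l" using c ksub_finite[OF c] by (simp_all add: ksub_def)
    show "card (a \<inter> c) = l \<longleftrightarrow> c \<subseteq> a"
      using fc card_subset_eq[of c "a \<inter> c"] by (auto simp: Int_absorb1)
    show "card (c \<inter> b) = l \<longleftrightarrow> c \<subseteq> b"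
      using fc card_subset_eq[of c "c \<inter> b"] by (auto simp: Int_absorb2)
  qed
  have "?L a b = (\<Sum>c\<in>ksub v l. if c \<subseteq> a \<inter> b then 1 else 0)"
    unfolding mmul_def using ab sub by (intro sum.cong) (auto simp: inter_mat_def)
  also have "\<dots> = of_nat (card {c \<in> ksub v l. c \<subseteq> a \<inter> b})"
    by (subst sum.inter_filter[OF finite_ksub, symmetric]) simp
  also have "{c \<in> ksub v l. c \<subseteq> a \<inter> b} = {c. c \<subseteq> a \<inter> b \<and> card c = l}"
    using ab by (auto simp: ksub_def)
  also have "card \<dots> = card (a \<inter> b) choose l"
    by (rule n_subsets[OF fin])
  also have "of_nat \<dots> = ?R a b"
    using ab card_Int_le'[OF ab(2), of a]
    by (auto simp: inter_mat_def mscale_def le_Suc_eq binomial_eq_0)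
  finally show "?L a b = ?R a b" .
qed

text \<open>The inclusion matrix between \<open>k\<close>-sets and the empty set is a column of ones, and the graph is
  regular. In the step from \<open>l\<close> to \<open>l + 1\<close>, the columns of the inclusion matrix are eigenvectors modulo
  the column space of the preceding one.\<close>

lemma adj_mult_incl_0:
  "mmul (ksub v k) (johnson_adj v k) (inter_mat 0 k 0 v) = mscale (johnson_eig v k 0) (inter_mat 0 k 0 v)"
proof (cases "k \<le> v")
  case True
  then show ?thesis
    unfolding adj_mult_inter by (simp add: inter_mat_eq_0 mat_space.scale_zero_right johnson_eig_def of_nat_diff)
next
  case False
  then have "ksub v k = {}"
    by (auto simp: ksub_def dest!: card_mono[rotated])
  then show ?thesis
    by (auto simp: mmul_def inter_mat_def mscale_def fun_eq_iff)
qed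

lemma adj_mult_incl_Suc:
  assumes "l < k" "k \<le> v"
  shows "mmul (ksub v k) (johnson_adj v k) (inter_mat (Suc l) k (Suc l) v)
     = mscale (johnson_eig v k (Suc l)) (inter_mat (Suc l) k (Suc l) v)
     + mscale (of_nat (k - l)) (mmul (ksub v l) (inter_mat l k l v) (inter_mat l l (Suc l) v))"
proof -
  obtain m where k: "k = Suc l + m" using assms(1) by (metis Suc_leI le_Suc_ex)
  obtain n where v: "v = k + n" using assms(2) by (metis le_Suc_ex)
  show ?thesis
    unfolding adj_mult_inter incl_mult_incl[OF assms(1)]
    by (simp add: inter_mat_eq_0 johnson_eig_def fun_eq_iff mscale_def k v algebra_simps)
qed

section \<open>Complements\<close>

lemma card_compl_Int:
  assumes "a \<in> ksub v i" "b \<in> ksub v j"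
  shows "card (({1..v} - a) \<inter> ({1..v} - b)) + (i + j) = v + card (a \<inter> b)"
proof -
  have "({1..v} - a) \<inter> ({1..v} - b) = {1..v} - (a \<union> b)" by blast
  moreover have "a \<union> b \<subseteq> {1..v}" using assms by (auto simp: ksub_def)
  moreover have "card (a \<union> b) \<le> v" using card_mono[OF _ \<open>a \<union> b \<subseteq> {1..v}\<close>] by simp
  ultimately show ?thesis
    using card_Un_ksub[OF assms] card_Diff_subset[of "a \<union> b" "{1..v}"]
      finite_subset[of "a \<union> b" "{1..v}"] by simp
qed

lemma compl_ksub:
  assumes "a \<in> ksub v k" shows "{1..v} - a \<in> ksub v (v - k)"
  using assms ksub_finite[OF assms] by (simp add: ksub_def card_Diff_subset Diff_subset)

lemma double_compl: "a \<in> ksub v k \<Longrightarrow> {1..v} - ({1..v} - a) = a"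
  by (auto simp: ksub_def)

lemma bij_compl:
  assumes "k \<le> v" shows "bij_betw (\<lambda>a. {1..v} - a) (ksub v k) (ksub v (v - k))"
proof (rule bij_betw_byWitness[where f' = "\<lambda>a. {1..v} - a"])
  show "(\<lambda>a. {1..v} - a) ` ksub v (v - k) \<subseteq> ksub v k"
    using compl_ksub[of _ v "v - k"] assms by auto
qed (use double_compl compl_ksub in blast)+

lemma johnson_adj_compl:
  assumes "k \<le> v" "a \<in> ksub v k" "b \<in> ksub v k"
  shows "johnson_adj v (v - k) ({1..v} - a) ({1..v} - b) = johnson_adj v k a b"
proof -
  have "Suc (card (({1..v} - a) \<inter> ({1..v} - b))) = v - k \<longleftrightarrow> Suc (card (a \<inter> b)) = k"
    using card_compl_Int[OF assms(2,3)] assms(1) by linarith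
  then show ?thesis
    using assms compl_ksub by (simp add: johnson_adj_def)
qed

lemma johnson_eig_compl: "k \<le> v \<Longrightarrow> johnson_eig v (v - k) j = johnson_eig v k j"
  unfolding johnson_eig_def by (simp add: of_nat_diff algebra_simps)

lemma incl_mat_compl:
  assumes "i \<le> v" "j \<le> v" "a \<in> ksub v i" "b \<in> ksub v j"
  shows "incl_mat (v - i) (v - j) v ({1..v} - a) ({1..v} - b) = incl_mat i j v a b"
proof -
  have "card (({1..v} - a) \<inter> ({1..v} - b)) = min (v - i) (v - j) \<longleftrightarrow> card (a \<inter> b) = min i j"
    using card_compl_Int[OF assms(3,4)] assms(1,2) by linarith
  then show ?thesis
    using assms compl_ksub by (simp add: inter_mat_def)
qed


section \<open>The spectral decomposition of the Johnson graph\<close>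

text \<open>The product of the linear factors of the first \<open>l + 1\<close> eigenvalues annihilates the
  inclusion matrix between \<open>k\<close>-sets and \<open>l\<close>-sets. For \<open>l = k\<close> the latter is the identity.\<close>

lemma node_poly_incl:
  assumes "l \<le> k" "k \<le> v"
  shows "mmul (ksub v k) (mat_poly (ksub v k) (johnson_adj v k) (\<Prod>j\<le>l. [:- johnson_eig v k j, 1:]))
           (inter_mat l k l v) = 0"
  using assms(1)
proof (induction l)
  case 0
  have "mmul (ksub v k) (mat_poly (ksub v k) (johnson_adj v k) [:- johnson_eig v k 0, 1:]) (inter_mat 0 k 0 v)
      = mscale (- johnson_eig v k 0) (inter_mat 0 k 0 v) + mscale (johnson_eig v k 0) (inter_mat 0 k 0 v)"
    by (simp only: mat_poly_linear[OF finite_ksub mats_adj] mmul_add_left mmul_mscale_left adj_mult_incl_0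
        mmul_mone_left[OF finite_ksub mats_inter])
  then show ?case
    by (simp add: mscale_def fun_eq_iff)
next
  case (Suc l)
  let ?I = "ksub v k" and ?A = "johnson_adj v k"
  let ?P = "mat_poly ?I ?A (\<Prod>j\<le>l. [:- johnson_eig v k j, 1:])"
  have "mmul ?I (mat_poly ?I ?A (\<Prod>j\<le>Suc l. [:- johnson_eig v k j, 1:])) (inter_mat (Suc l) k (Suc l) v)
      = mmul ?I ?P (mmul ?I (mat_poly ?I ?A [:- johnson_eig v k (Suc l), 1:]) (inter_mat (Suc l) k (Suc l) v))"
    by (simp only: prod.atMost_Suc mat_poly_mult[OF finite_ksub mats_adj] mmul_assoc)
  also have "mmul ?I (mat_poly ?I ?A [:- johnson_eig v k (Suc l), 1:]) (inter_mat (Suc l) k (Suc l) v)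
      = mscale (of_nat (k - l)) (mmul (ksub v l) (inter_mat l k l v) (inter_mat l l (Suc l) v))"
    using Suc.prems assms(2)
    unfolding mat_poly_linear[OF finite_ksub mats_adj] mmul_add_left mmul_mscale_left
      mmul_mone_left[OF finite_ksub mats_inter]
    by (subst adj_mult_incl_Suc) (simp_all add: mscale_def fun_eq_iff)
  also have "mmul ?I ?P \<dots>
      = mscale (of_nat (k - l)) (mmul (ksub v l) (mmul ?I ?P (inter_mat l k l v)) (inter_mat l l (Suc l) v))"
    by (simp only: mmul_mscale_right mmul_assoc)
  also have "\<dots> = 0"
    using Suc by (simp add: mmul_zero_left mat_space.scale_zero_right del: zero_fun_apply)
  finally show ?case .
qed

lemma node_poly_half:
  assumes "k \<le> v"
  shows "mat_poly (ksub v k) (johnson_adj v k) (\<Prod>j\<le>k. [:- johnson_eig v k j, 1:]) = 0"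
  using node_poly_incl[OF order_refl assms]
  by (simp only: inter_mat_mone mmul_mone_right[OF finite_ksub mats_mat_poly[OF mats_adj]])

text \<open>If \<open>k > v - k\<close>, complementation reduces the claim to \<open>J(v,v-k)\<close>, which has the same
  eigenvalues.\<close>

lemma node_poly_adj:
  assumes "k \<le> v"
  shows "mat_poly (ksub v k) (johnson_adj v k) (\<Prod>j\<le>min k (v - k). [:- johnson_eig v k j, 1:]) = 0"
    (is "?M = 0")
proof (cases "k \<le> v - k")
  case True
  then show ?thesis using node_poly_half[OF assms] by (simp add: min_def)
next
  case False
  show ?thesis
  proof (rule mats_eqI)
    show "?M \<in> mats (ksub v k) (ksub v k)" by (rule mats_mat_poly[OF mats_adj])
  next
    fix a b assume ab: "a \<in> ksub v k" "b \<in> ksub v k"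
    have "?M a b = mat_poly (ksub v (v - k)) (johnson_adj v (v - k))
        (\<Prod>j\<le>v - k. [:- johnson_eig v (v - k) j, 1:]) ({1..v} - a) ({1..v} - b)"
      using mat_poly_transport[of _ _ _ "johnson_adj v (v - k)" "johnson_adj v k", OF bij_compl[OF assms]
          johnson_adj_compl[OF assms] ab] False assms
      by (simp add: johnson_eig_compl min_def)
    then show "?M a b = 0 a b"
      by (simp add: node_poly_half)
  qed (rule mats_zero)
qed

lemma johnson_eig_inj: "inj_on (johnson_eig v k) {..min k (v - k)}"
proof -
  have less: "johnson_eig v k j \<noteq> johnson_eig v k l" if "j < l" "l \<le> min k (v - k)" for j l
  proof -
    have k: "k \<le> v" using that by linarith
    then have "int (v - k) = int v - int k" by simp
    moreover have "(int l - int j) * (int v + 1 - int l - int j) > 0"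
      using that k by (intro mult_pos_pos) auto
    moreover have "((int k - int j) * (int v - int k - int j) - int j)
        - ((int k - int l) * (int v - int k - int l) - int l)
        = (int l - int j) * (int v + 1 - int l - int j)"
      by (simp add: algebra_simps)
    ultimately show ?thesis unfolding johnson_eig_def of_int_eq_iff by linarith
  qed
  show ?thesis
    by (rule linorder_inj_onI) (use less in auto)
qed

lemma prod_linear_dvd:
  fixes p :: "complex poly"
  assumes "finite S" "inj_on t S" "\<And>s. s \<in> S \<Longrightarrow> poly p (t s) = 0"
  shows "(\<Prod>s\<in>S. [:- t s, 1:]) dvd p"
  using assms
proof (induction S)
  case (insert x S)
  then obtain q where q: "p = (\<Prod>s\<in>S. [:- t s, 1:]) * q" by (auto elim!: dvdE)
  have "poly (\<Prod>s\<in>S. [:- t s, 1:]) (t x) \<noteq> 0"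
    using insert by (auto simp: poly_prod)
  then have "[:- t x, 1:] dvd q"
    using insert.prems(2)[of x] by (simp add: q poly_eq_0_iff_dvd)
  then show ?case
    unfolding prod.insert[OF insert.hyps] q by (subst mult.commute) (rule mult_dvd_mono[OF dvd_refl])
qed simp

lemma mat_poly_adj_vanish:
  assumes "k \<le> v" "\<And>l. l \<le> min k (v - k) \<Longrightarrow> poly p (johnson_eig v k l) = 0"
  shows "mat_poly (ksub v k) (johnson_adj v k) p = 0"
proof -
  obtain q where "p = (\<Prod>j\<le>min k (v - k). [:- johnson_eig v k j, 1:]) * q"
    using prod_linear_dvd[OF finite_atMost johnson_eig_inj, of k v p] assms(2) unfolding dvd_def by blast
  then show ?thesis
    by (simp add: mat_poly_mult[OF finite_ksub mats_adj] node_poly_adj[OF assms(1)] mmul_zero_left del: zero_fun_apply)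
qed

text \<open>The Lagrange polynomial that is \<open>1\<close> at the \<open>r\<close>-th eigenvalue of \<open>J(v,k)\<close> and \<open>0\<close> at the
  others.\<close>

definition johnson_lagrange :: "nat \<Rightarrow> nat \<Rightarrow> nat \<Rightarrow> complex poly" where
  "johnson_lagrange v k r =
     smult (inverse (\<Prod>l\<in>{..min k (v - k)} - {r}. johnson_eig v k r - johnson_eig v k l))
       (\<Prod>l\<in>{..min k (v - k)} - {r}. [:- johnson_eig v k l, 1:])"

lemma poly_johnson_lagrange:
  assumes "r \<le> min k (v - k)" "s \<le> min k (v - k)"
  shows "poly (johnson_lagrange v k r) (johnson_eig v k s) = (if s = r then 1 else 0)"
proof (cases "s = r")
  case True
  have "johnson_eig v k r \<noteq> johnson_eig v k l" if "l \<in> {..min k (v - k)} - {r}" for l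
    using that assms johnson_eig_inj[of v k] by (auto simp: inj_on_def)
  then show ?thesis
    using True by (simp add: johnson_lagrange_def poly_prod)
next
  case False
  then show ?thesis
    using assms by (auto simp: johnson_lagrange_def poly_prod)
qed

lemma mvec_mmul: "mvec J (mmul K M N) u = mvec K M (mvec J N u)"
proof
  fix a
  have "(\<Sum>b\<in>J. \<Sum>c\<in>K. M a c * (N c b * u b)) = (\<Sum>c\<in>K. \<Sum>b\<in>J. M a c * (N c b * u b))"
    by (rule sum.swap)
  then show "mvec J (mmul K M N) u a = mvec K M (mvec J N u) a"
    unfolding mvec_def mmul_def by (simp add: sum_distrib_left sum_distrib_right mult.assoc)
qed

lemma mvec_add: "mvec J (M + N) u = mvec J M u + mvec J N u"
  unfolding mvec_def by (simp add: fun_eq_iff algebra_simps sum.distrib)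

lemma mvec_mscale: "mvec J (mscale c M) u = (\<lambda>a. c * mvec J M u a)"
  unfolding mvec_def mscale_def by (simp add: fun_eq_iff sum_distrib_left mult.assoc)

lemma mvec_mone: "finite I \<Longrightarrow> u \<in> vecs I \<Longrightarrow> mvec I (mone I) u = u"
proof
  fix a assume I: "finite I" and u: "u \<in> vecs I"
  have "mvec I (mone I) u a = (\<Sum>b\<in>I. if a = b then u b else 0)"
    unfolding mvec_def mone_def by (intro sum.cong) auto
  then show "mvec I (mone I) u a = u a"
    using I u by (auto simp: vecs_def)
qed

lemma vecs_mvec: "M \<in> mats I J \<Longrightarrow> mvec J M u \<in> vecs I"
  unfolding vecs_def mvec_def by (auto simp: matsD) (metis (no_types, lifting) matsD mult_zero_left sum.neutral)

lemma cinner_diff_left: "cinner I (u - u') w = cinner I u w - cinner I u' w"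
  unfolding cinner_def by (simp add: algebra_simps sum_subtractf)

lemma cinner_self_eq_0:
  assumes "finite I" "u \<in> vecs I" "cinner I u u = 0"
  shows "u = 0"
proof -
  have "cinner I u u = of_real (\<Sum>a\<in>I. (cmod (u a))\<^sup>2)"
    unfolding cinner_def by (simp add: complex_norm_square[symmetric])
  then have "(\<Sum>a\<in>I. (cmod (u a))\<^sup>2) = 0"
    using assms(3) by (metis of_real_eq_0_iff)
  then have "\<forall>a\<in>I. u a = 0"
    using assms(1) by (simp add: sum_nonneg_eq_0_iff)
  then show ?thesis
    using assms(2) by (auto simp: vecs_def fun_eq_iff)
qed

text \<open>Since \<open>orth_proj\<close> is a definite description, identifying it includes the uniqueness of the
  orthogonal projection.\<close>

lemma orth_proj_eqI:
  assumes I: "finite I" and W: "W \<subseteq> vecs I" "\<And>u w. u \<in> W \<Longrightarrow> w \<in> W \<Longrightarrow> u - w \<in> W"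
    and P: "P \<in> mats I I"
    and P_in: "\<And>u. u \<in> vecs I \<Longrightarrow> mvec I P u \<in> W"
    and P_orth: "\<And>u w. u \<in> vecs I \<Longrightarrow> w \<in> W \<Longrightarrow> cinner I (u - mvec I P u) w = 0"
  shows "orth_proj I W = P"
  unfolding orth_proj_def
proof (rule the_equality)
  fix P' assume P': "P' \<in> mats I I \<and>
     (\<forall>u\<in>vecs I. mvec I P' u \<in> W \<and> (\<forall>w\<in>W. cinner I (u - mvec I P' u) w = 0))"
  have same: "mvec I P' u = mvec I P u" if u: "u \<in> vecs I" for u
  proof -
    let ?x = "mvec I P' u - mvec I P u"
    have x: "?x \<in> W" using P' P_in u W(2) by blast
    have "cinner I ?x ?x = cinner I (u - mvec I P u) ?x - cinner I (u - mvec I P' u) ?x"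
      by (simp add: cinner_diff_left)
    also have "\<dots> = 0" using P' P_orth[OF u x] u x by simp
    finally have "?x = 0" using cinner_self_eq_0[OF I] x W(1) by blast
    then show ?thesis by simp
  qed
  have col: "mvec I M (\<lambda>c. if c = b then 1 else 0) a = M a b" if "b \<in> I" for M a b
    unfolding mvec_def using I that by (simp add: if_distrib cong: if_cong)
  show "P' = P"
  proof (rule mats_eqI[of _ I I])
    fix a b assume "a \<in> I" "b \<in> I"
    then show "P' a b = P a b"
      using same[of "\<lambda>c. if c = b then 1 else 0"] col[of b P' a] col[of b P a] by (simp add: vecs_def)
  qed (use P P' in auto)
qed (use P P_in P_orth in blast)

lemma cinner_adj:
  "cinner (ksub v k) (mvec (ksub v k) (johnson_adj v k) u) w
     = cinner (ksub v k) u (mvec (ksub v k) (johnson_adj v k) w)"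
proof -
  have "(\<Sum>a\<in>ksub v k. \<Sum>b\<in>ksub v k. johnson_adj v k a b * u b * cnj (w a))
      = (\<Sum>b\<in>ksub v k. \<Sum>a\<in>ksub v k. u b * cnj (johnson_adj v k b a * w a))"
    by (subst sum.swap) (auto intro!: sum.cong simp: johnson_adj_def Int_commute)
  then show ?thesis
    unfolding cinner_def mvec_def by (simp add: sum_distrib_left sum_distrib_right)
qed

text \<open>The Lagrange polynomial \<open>L\<^sub>r\<close> at \<open>A\<close> is the projection: \<open>(X - \<theta>\<^sub>r) L\<^sub>r\<close> vanishes at all
  eigenvalues, so the image lies in the eigenspace; and \<open>1 - L\<^sub>r\<close> is divisible by \<open>X - \<theta>\<^sub>r\<close>, so the
  complementary projection maps into the range of \<open>A - \<theta>\<^sub>r\<close>, which is orthogonal to the eigenspace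
  because \<open>A\<close> is symmetric and \<open>\<theta>\<^sub>r\<close> is real.\<close>

lemma prim_idem_lagrange:
  assumes k: "k \<le> v" and r: "r \<le> min k (v - k)"
  shows "prim_idem v k r = mat_poly (ksub v k) (johnson_adj v k) (johnson_lagrange v k r)"
proof -
  let ?I = "ksub v k" and ?A = "johnson_adj v k" and ?t = "johnson_eig v k r"
    and ?L = "johnson_lagrange v k r"
  let ?P = "mat_poly ?I ?A ?L" and ?W = "eigspace ?I ?A ?t"
  have lin: "mvec ?I (mat_poly ?I ?A [:- ?t, 1:]) u = (\<lambda>a. mvec ?I ?A u a - ?t * u a)" if "u \<in> vecs ?I" for u
    unfolding mat_poly_linear[OF finite_ksub mats_adj] mvec_add mvec_mscale mvec_mone[OF finite_ksub that]
    by (simp add: fun_eq_iff)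
  have "orth_proj ?I ?W = ?P"
  proof (rule orth_proj_eqI)
    show "?W \<subseteq> vecs ?I" by (auto simp: eigspace_def)
    show "u - w \<in> ?W" if "u \<in> ?W" "w \<in> ?W" for u w
    proof -
      have "u - w \<in> vecs ?I" using that unfolding eigspace_def vecs_def by force
      then show ?thesis
        using that by (auto simp: eigspace_def mvec_def fun_eq_iff algebra_simps sum_subtractf)
    qed
    show "?P \<in> mats ?I ?I" by (rule mats_mat_poly[OF mats_adj])
    show "mvec ?I ?P u \<in> ?W" if u: "u \<in> vecs ?I" for u
    proof -
      have Pu: "mvec ?I ?P u \<in> vecs ?I" by (rule vecs_mvec[OF mats_mat_poly[OF mats_adj]])
      have "mat_poly ?I ?A ([:- ?t, 1:] * ?L) = 0"
      proof (rule mat_poly_adj_vanish[OF k])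
        fix l assume "l \<le> min k (v - k)"
        then show "poly ([:- ?t, 1:] * ?L) (johnson_eig v k l) = 0"
          unfolding poly_mult by (subst poly_johnson_lagrange[OF r]) auto
      qed
      then have "mvec ?I (mat_poly ?I ?A [:- ?t, 1:]) (mvec ?I ?P u) = 0"
        unfolding mat_poly_mult[OF finite_ksub mats_adj] mvec_mmul[symmetric]
        by (simp only:) (simp add: mvec_def fun_eq_iff)
      then show ?thesis
        using Pu unfolding lin[OF Pu] by (simp add: eigspace_def fun_eq_iff)
    qed
    show "cinner ?I (u - mvec ?I ?P u) w = 0" if u: "u \<in> vecs ?I" and w: "w \<in> ?W" for u w
    proof -
      have "poly (1 - ?L) ?t = 0" using poly_johnson_lagrange[OF r r] by simp
      then obtain q where q: "1 - ?L = [:- ?t, 1:] * q" unfolding poly_eq_0_iff_dvd dvd_def by blast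
      let ?z = "mvec ?I (mat_poly ?I ?A q) u"
      have z: "?z \<in> vecs ?I" by (rule vecs_mvec[OF mats_mat_poly[OF mats_adj]])
      have "mone ?I = mat_poly ?I ?A (?L + [:- ?t, 1:] * q)"
        unfolding q[symmetric] by (simp add: mat_poly_1)
      then have "mvec ?I (mone ?I) u = mvec ?I ?P u + mvec ?I (mat_poly ?I ?A [:- ?t, 1:]) ?z"
        by (simp only: mat_poly_add mat_poly_mult[OF finite_ksub mats_adj] mvec_add mvec_mmul)
      then have "u - mvec ?I ?P u = mvec ?I ?A ?z - (\<lambda>a. ?t * ?z a)"
        unfolding mvec_mone[OF finite_ksub u] lin[OF z] by (simp add: fun_eq_iff)
      moreover have "cinner ?I (mvec ?I ?A ?z) w = ?t * cinner ?I ?z w"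
      proof -
        have "mvec ?I ?A w = (\<lambda>a. ?t * w a)" using w by (simp add: eigspace_def)
        moreover have "cnj ?t = ?t" unfolding johnson_eig_def by simp
        ultimately show ?thesis
          unfolding cinner_adj by (simp add: cinner_def sum_distrib_left mult_ac)
      qed
      ultimately show ?thesis
        by (simp add: cinner_diff_left) (simp add: cinner_def sum_distrib_left mult.assoc)
    qed
  qed (rule finite_ksub)
  then show ?thesis using r by (simp add: prim_idem_def)
qed

lemma mat_poly_spectral:
  assumes k: "k \<le> v"
  shows "mat_poly (ksub v k) (johnson_adj v k) p
     = (\<Sum>r\<le>min k (v - k). mscale (poly p (johnson_eig v k r)) (prim_idem v k r))"
proof -
  let ?q = "\<Sum>r\<le>min k (v - k). smult (poly p (johnson_eig v k r)) (johnson_lagrange v k r)"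
  have "mat_poly (ksub v k) (johnson_adj v k) (p + smult (- 1) ?q) = 0"
  proof (rule mat_poly_adj_vanish[OF k])
    fix l assume l: "l \<le> min k (v - k)"
    have "poly ?q (johnson_eig v k l)
        = (\<Sum>r\<le>min k (v - k). if r = l then poly p (johnson_eig v k r) else 0)"
      unfolding poly_sum using l by (intro sum.cong) (auto simp: poly_johnson_lagrange)
    also have "\<dots> = poly p (johnson_eig v k l)" using l by (simp only: sum.delta finite_atMost atMost_iff if_True)
    finally show "poly (p + smult (- 1) ?q) (johnson_eig v k l) = 0" by simp
  qed
  then have "mat_poly (ksub v k) (johnson_adj v k) p = mat_poly (ksub v k) (johnson_adj v k) ?q"
    unfolding mat_poly_add mat_poly_smult by (simp add: mscale_def fun_eq_iff)
  also have "\<dots> = (\<Sum>r\<le>min k (v - k). mscale (poly p (johnson_eig v k r)) (prim_idem v k r))"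
    unfolding mat_poly_sum mat_poly_smult using prim_idem_lagrange[OF k] by (intro sum.cong) auto
  finally show ?thesis .
qed

lemma prim_idem_poly:
  assumes "k \<le> v"
  obtains p where "prim_idem v k r = mat_poly (ksub v k) (johnson_adj v k) p"
proof (cases "r \<le> min k (v - k)")
  case False
  then have "prim_idem v k r = mat_poly (ksub v k) (johnson_adj v k) 0"
    unfolding prim_idem_def mat_poly_0 by (rule if_not_P)
  then show thesis using that by blast
qed (use prim_idem_lagrange[OF assms] that in blast)

lemma mats_prim_idem:
  assumes "k \<le> v" shows "prim_idem v k r \<in> mats (ksub v k) (ksub v k)"
  using prim_idem_poly[OF assms, of r] mats_mat_poly[OF mats_adj] by metis

text \<open>Complementation carries the idempotents of \<open>J(v,k)\<close> to those of \<open>J(v,v-k)\<close>, because both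
  are given by the same Lagrange polynomials.\<close>

lemma prim_idem_compl:
  assumes k: "k \<le> v" and ab: "a \<in> ksub v k" "b \<in> ksub v k"
  shows "prim_idem v (v - k) r ({1..v} - a) ({1..v} - b) = prim_idem v k r a b"
proof (cases "r \<le> min k (v - k)")
  case True
  have "johnson_lagrange v (v - k) r = johnson_lagrange v k r"
    using k by (simp add: johnson_lagrange_def johnson_eig_compl min.commute)
  then have "prim_idem v (v - k) r = mat_poly (ksub v (v - k)) (johnson_adj v (v - k)) (johnson_lagrange v k r)"
    using prim_idem_lagrange[of "v - k" v r] True k by simp
  then show ?thesis
    using mat_poly_transport[of _ _ _ "johnson_adj v (v - k)" "johnson_adj v k", OF bij_compl[OF k]
        johnson_adj_compl[OF k] ab] prim_idem_lagrange[OF k True] by simp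
next
  case False
  then have "prim_idem v (v - k) r = 0" "prim_idem v k r = 0"
    using k by (auto simp: prim_idem_def)
  then show ?thesis by simp
qed

section \<open>Intersection matrices and primitive idempotents\<close>

text \<open>By downward induction on \<open>p\<close>: in the tridiagonal relation for \<open>A H\<^sup>p\<^sup>+\<^sup>1\<close> the
  coefficient of \<open>H\<^sup>p\<close> is \<open>(i - p)(j - p)\<close>, which is nonzero for \<open>p < min i j\<close>, so \<open>H\<^sup>p\<close> is determined
  by \<open>H\<^sup>p\<^sup>+\<^sup>1\<close> and \<open>H\<^sup>p\<^sup>+\<^sup>2\<close>.\<close>

lemma inter_mat_poly:
  assumes p: "p \<le> min i j"
  shows "\<exists>q. inter_mat p i j v = mmul (ksub v i) (mat_poly (ksub v i) (johnson_adj v i) q) (incl_mat i j v)"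
proof -
  let ?I = "ksub v i" and ?A = "johnson_adj v i"
  define B where "B q = mmul ?I (mat_poly ?I ?A q) (incl_mat i j v)" for q
  have B_add: "B (q + q') = B q + B q'" for q q'
    by (simp only: B_def mat_poly_add mmul_add_left)
  have B_smult: "B (smult c q) = mscale c (B q)" for c q
    by (simp only: B_def mat_poly_smult mmul_mscale_left)
  have B_adj: "B ([:0, 1:] * q) = mmul ?I ?A (B q)" for q
    by (simp only: B_def mat_poly_mult[OF finite_ksub mats_adj] mat_poly_X[OF finite_ksub mats_adj] mmul_assoc)
  have "(\<exists>q. inter_mat p i j v = B q) \<and> (\<exists>q. inter_mat (Suc p) i j v = B q)"
    using p
  proof (induction p rule: inc_induct)
    case base
    have "inter_mat (min i j) i j v = B 1"
      by (simp only: B_def mat_poly_1 mmul_mone_left[OF finite_ksub mats_inter])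
    moreover have "inter_mat (Suc (min i j)) i j v = B 0"
      unfolding B_def mat_poly_0 mmul_zero_left by (rule inter_mat_eq_0) simp
    ultimately show ?case by blast
  next
    case (step n)
    then obtain q1 q2 where q: "inter_mat (Suc n) i j v = B q1" "inter_mat (Suc (Suc n)) i j v = B q2"
      by blast
    define e :: complex where "e = of_nat (i - n) * of_nat (j - n)"
    have e: "e \<noteq> 0" using step.hyps by (simp add: e_def)
    obtain b c :: complex where bc: "mmul ?I ?A (inter_mat (Suc n) i j v)
        = mscale c (inter_mat (Suc (Suc n)) i j v) + mscale b (inter_mat (Suc n) i j v) + mscale e (inter_mat n i j v)"
      using adj_mult_inter[of v i "Suc n" j] unfolding e_def by auto
    have "B (smult (inverse e) ([:0, 1:] * q1 + smult (- c) q2 + smult (- b) q1))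
        = mscale (inverse e) (mmul ?I ?A (inter_mat (Suc n) i j v) + mscale (- c) (inter_mat (Suc (Suc n)) i j v)
            + mscale (- b) (inter_mat (Suc n) i j v))"
      by (simp only: B_add B_smult B_adj q)
    also have "\<dots> = inter_mat n i j v"
      unfolding bc using e by (simp add: mscale_def fun_eq_iff)
    finally show ?case using q(1) by metis
  qed
  then show ?thesis unfolding B_def by blast
qed

text \<open>The product of the \<open>r\<close>-th primitive idempotent of \<open>J(v,i)\<close> with the inclusion matrix between
  \<open>i\<close>-sets and \<open>j\<close>-sets.\<close>

definition idem_incl :: "nat \<Rightarrow> nat \<Rightarrow> nat \<Rightarrow> nat \<Rightarrow> (nat set, nat set) cmatrix" where
  "idem_incl v i j r = mmul (ksub v i) (prim_idem v i r) (incl_mat i j v)"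

lemma mats_idem_incl: "i \<le> v \<Longrightarrow> idem_incl v i j r \<in> mats (ksub v i) (ksub v j)"
  unfolding idem_incl_def by (rule mats_mmul[OF mats_prim_idem mats_inter])

lemma idem_incl_compl:
  assumes ij: "i \<le> v" "j \<le> v" and ab: "a \<in> ksub v i" "b \<in> ksub v j"
  shows "idem_incl v (v - i) (v - j) r ({1..v} - a) ({1..v} - b) = idem_incl v i j r a b"
  unfolding idem_incl_def mmul_def
  by (subst sum.reindex_bij_betw[OF bij_compl[OF ij(1)], symmetric])
     (intro sum.cong refl, simp only: prim_idem_compl[OF ij(1) ab(1)] incl_mat_compl[OF ij _ ab(2)])

lemma inter_mat_expand:
  assumes "p \<le> min i j" "i \<le> v"
  shows "\<exists>c. inter_mat p i j v = (\<Sum>r\<le>min i (v - i). mscale (c r) (idem_incl v i j r))"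
proof -
  obtain q where "inter_mat p i j v = mmul (ksub v i) (mat_poly (ksub v i) (johnson_adj v i) q) (incl_mat i j v)"
    using inter_mat_poly[OF assms(1)] by blast
  then have "inter_mat p i j v = (\<Sum>r\<le>min i (v - i). mscale (poly q (johnson_eig v i r)) (idem_incl v i j r))"
    by (simp only: mat_poly_spectral[OF assms(2)] mmul_sum_left mmul_mscale_left idem_incl_def)
  then show ?thesis by (rule exI[where x = "\<lambda>r. poly q (johnson_eig v i r)"])
qed

lemma N_gen_eq:
  "N_gen d i j r s = kron (idem_incl d (d - i) (d - j) r) (idem_incl d i j s)
     + kron (idem_incl d (d - i) (d - j) s) (idem_incl d i j r)"
  unfolding N_gen_def idem_incl_def by (simp only: mmul_add_left mmul_kron)

lemma N_gen_in_N_space: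
  assumes "r \<le> d - i" "s \<le> d - i"
  shows "N_gen d i j r s \<in> N_space d i j"
proof -
  have "N_gen d i j r s = N_gen d i j s r"
    unfolding N_gen_eq by (rule add.commute)
  moreover have "N_gen d i j r s \<in> N_space d i j" if "r \<le> s" "s \<le> d - i" for r s
    unfolding N_space_def using that by (intro mat_space.span_base) auto
  ultimately show ?thesis using assms by (metis linear)
qed

text \<open>Every symmetric function of the two intersection sizes is realised in \<open>N_space\<close>. The
  complements in the first coordinates appear because the rows and columns of \<open>N_space d i j\<close> are
  indexed by \<open>(d - i)\<close>-sets and \<open>(d - j)\<close>-sets there.\<close>

lemma N_space_symmetric_fun:
  fixes \<Phi> :: "nat \<Rightarrow> nat \<Rightarrow> complex"
  assumes ij: "i \<le> d" "j \<le> d" and sym: "\<And>p q. \<Phi> p q = \<Phi> q p"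
  obtains Y where "Y \<in> N_space d i j"
    "\<And>a b a' b'. a \<in> ksub d i \<Longrightarrow> b \<in> ksub d i \<Longrightarrow> a' \<in> ksub d j \<Longrightarrow> b' \<in> ksub d j
       \<Longrightarrow> Y ({1..d} - a, b) ({1..d} - a', b') = \<Phi> (card (a \<inter> a')) (card (b \<inter> b'))"
proof -
  let ?m = "min i j" and ?k = "min i (d - i)"
  have "\<exists>c. \<forall>p\<in>{..?m}. inter_mat p i j d = (\<Sum>r\<le>?k. mscale (c p r) (idem_incl d i j r))"
    by (rule bchoice) (use inter_mat_expand[of _ i j d] ij in auto)
  then obtain c where c: "inter_mat p i j d = (\<Sum>r\<le>?k. mscale (c p r) (idem_incl d i j r))"
    if "p \<le> ?m" for p by auto
  \<comment> \<open>\<open>H p\<close> is the matrix of intersection size \<open>p\<close>, and \<open>K p\<close> is its transport under complementation.\<close>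
  define K where "K p = (\<Sum>r\<le>?k. mscale (c p r) (idem_incl d (d - i) (d - j) r))" for p
  define H where "H p = (\<Sum>r\<le>?k. mscale (c p r) (idem_incl d i j r))" for p
  have H: "H p b b' = (if card (b \<inter> b') = p then 1 else 0)"
    if "p \<le> ?m" "b \<in> ksub d i" "b' \<in> ksub d j" for p b b'
  proof -
    have "H p b b' = inter_mat p i j d b b'"
      unfolding H_def by (simp only: c[OF that(1)])
    then show ?thesis using that by (simp add: inter_mat_def)
  qed
  have K: "K p ({1..d} - a) ({1..d} - a') = (if card (a \<inter> a') = p then 1 else 0)"
    if "p \<le> ?m" "a \<in> ksub d i" "a' \<in> ksub d j" for p a a'
  proof -
    have "K p ({1..d} - a) ({1..d} - a') = H p a a'"
      unfolding K_def H_def sum_mat_apply mscale_apply using that ij by (simp only: idem_incl_compl)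
    then show ?thesis using H[OF that] by simp
  qed
  define S where "S p q = kron (K p) (H q) + kron (K q) (H p)" for p q
  have S: "S p q \<in> N_space d i j" for p q
  proof -
    have "S p q = (\<Sum>r\<le>?k. \<Sum>s\<le>?k. mscale (c p r * c q s) (N_gen d i j r s))"
    proof -
      have "kron (K q) (H p) = (\<Sum>r\<le>?k. \<Sum>s\<le>?k. mscale (c p r * c q s)
          (kron (idem_incl d (d - i) (d - j) s) (idem_incl d i j r)))"
        unfolding K_def H_def kron_sum_sum by (subst sum.swap) (simp only: mult.commute)
      moreover have "kron (K p) (H q) = (\<Sum>r\<le>?k. \<Sum>s\<le>?k. mscale (c p r * c q s)
          (kron (idem_incl d (d - i) (d - j) r) (idem_incl d i j s)))"
        by (simp only: K_def H_def kron_sum_sum)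
      ultimately show ?thesis
        by (simp only: S_def N_gen_eq mat_space.scale_right_distrib sum.distrib)
    qed
    moreover have "N_gen d i j r s \<in> N_space d i j" if "r \<le> ?k" "s \<le> ?k" for r s
      by (rule N_gen_in_N_space) (use that in auto)
    ultimately show ?thesis
      unfolding N_space_def by (auto intro!: mat_space.span_sum mat_space.span_scale)
  qed
  \<comment> \<open>The sum runs over ordered pairs, so an entry receives both \<open>\<Phi> p q\<close> and \<open>\<Phi> q p\<close>; hence the
    factor \<open>1/2\<close>.\<close>
  define Y where "Y = (\<Sum>p\<le>?m. \<Sum>q\<le>?m. mscale (\<Phi> p q / 2) (S p q))"
  show thesis
  proof
    show "Y \<in> N_space d i j"
      unfolding Y_def using S unfolding N_space_def by (intro mat_space.span_sum mat_space.span_scale)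
    fix a b a' b'
    assume *: "a \<in> ksub d i" "b \<in> ksub d i" "a' \<in> ksub d j" "b' \<in> ksub d j"
    let ?p = "card (a \<inter> a')" and ?q = "card (b \<inter> b')"
    have le: "?p \<le> ?m" "?q \<le> ?m"
      using * card_Int_le card_Int_le' by (metis min.boundedI)+
    have "Y ({1..d} - a, b) ({1..d} - a', b')
        = (\<Sum>p\<le>?m. \<Sum>q\<le>?m. \<Phi> p q / 2 * (S p q) ({1..d} - a, b) ({1..d} - a', b'))"
      by (simp only: Y_def sum_mat_apply mscale_apply)
    also have "\<dots> = (\<Sum>p\<le>?m. \<Sum>q\<le>?m. (if q = ?q then if p = ?p then \<Phi> p q / 2 else 0 else 0)
        + (if q = ?p then if p = ?q then \<Phi> p q / 2 else 0 else 0))"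
      by (intro sum.cong refl) (use * in \<open>auto simp: S_def kron_def H K simp del: One_nat_def\<close>)
    also have "\<dots> = \<Phi> ?p ?q / 2 + \<Phi> ?q ?p / 2"
      using le by (simp add: sum.distrib)
    also have "\<dots> = \<Phi> ?p ?q" by (simp add: sym[of ?q ?p])
    finally show "Y ({1..d} - a, b) ({1..d} - a', b') = \<Phi> ?p ?q" .
  qed
qed


section \<open>Symmetric polynomials in two commuting copies of the adjacency matrix\<close>

text \<open>The distance-two matrix of \<open>J(v,k)\<close>. The successors avoid truncated subtraction, so that it
  is \<open>0\<close> for \<open>k < 2\<close>.\<close>

definition dist_two :: "nat \<Rightarrow> nat \<Rightarrow> (nat set, nat set) cmatrix" where
  "dist_two v k = (\<lambda>a b. if a \<in> ksub v k \<and> b \<in> ksub v k \<and> Suc (Suc (card (a \<inter> b))) = k then 1 else 0)"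

lemma adj_square:
  "\<exists>c0 c1. mmul (ksub v k) (johnson_adj v k) (johnson_adj v k)
     = mscale c0 (mone (ksub v k)) + mscale c1 (johnson_adj v k) + mscale 4 (dist_two v k)"
proof (cases k)
  case 0
  then have "johnson_adj v k = 0" "dist_two v k = 0"
    by (auto simp: johnson_adj_def dist_two_def fun_eq_iff)
  then have "mmul (ksub v k) (johnson_adj v k) (johnson_adj v k)
     = mscale 0 (mone (ksub v k)) + mscale 0 (johnson_adj v k) + mscale 4 (dist_two v k)"
    by (simp add: mmul_def mscale_def fun_eq_iff)
  then show ?thesis by blast
next
  case (Suc n)
  obtain c0 c1 where "mmul (ksub v k) (johnson_adj v k) (inter_mat n k k v)
     = mscale c0 (inter_mat (Suc n) k k v) + mscale c1 (inter_mat n k k v)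
       + (if n = 0 then 0 else mscale (of_nat (k - (n - 1)) * of_nat (k - (n - 1))) (inter_mat (n - 1) k k v))"
    using adj_mult_inter[of v k n k] by blast
  moreover have "(if n = 0 then 0 else mscale (of_nat (k - (n - 1)) * of_nat (k - (n - 1))) (inter_mat (n - 1) k k v))
      = mscale 4 (dist_two v k)"
    using Suc by (cases n) (auto simp: mscale_def dist_two_def inter_mat_def fun_eq_iff)
  moreover have "inter_mat n k k v = johnson_adj v k" "inter_mat (Suc n) k k v = mone (ksub v k)"
    using Suc inter_mat_adj inter_mat_mone by auto
  ultimately show ?thesis by auto
qed

text \<open>The symmetrised monomial \<open>A\<^sup>m \<otimes> A\<^sup>n + A\<^sup>n \<otimes> A\<^sup>m\<close> in the adjacency matrix \<open>A\<close> of
  \<open>J(v,k)\<close>.\<close>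

definition sym_pow :: "nat \<Rightarrow> nat \<Rightarrow> nat \<Rightarrow> nat \<Rightarrow> (nat set \<times> nat set, nat set \<times> nat set) cmatrix" where
  "sym_pow v k m n =
     kron (mat_pow (ksub v k) (johnson_adj v k) m) (mat_pow (ksub v k) (johnson_adj v k) n)
     + kron (mat_pow (ksub v k) (johnson_adj v k) n) (mat_pow (ksub v k) (johnson_adj v k) m)"

text \<open>The algebra of symmetric polynomials in \<open>A \<otimes> 1\<close> and \<open>1 \<otimes> A\<close> is generated by
  \<open>A \<otimes> 1 + 1 \<otimes> A\<close> and \<open>A \<otimes> A\<close>. As \<open>A\<^sup>2\<close> is a combination of \<open>1\<close>, \<open>A\<close> and the distance-two
  matrix \<open>A\<^sub>2\<close>, the second generator is a combination of \<open>1\<close>, the first generator, its square, and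
  \<open>A \<otimes> A + A\<^sub>2 \<otimes> 1 + 1 \<otimes> A\<^sub>2\<close>.\<close>

lemma symmetric_poly_generated:
  fixes S :: "(nat set \<times> nat set, nat set \<times> nat set) cmatrix set" and v k :: nat
  defines "P \<equiv> ksub v k \<times> ksub v k"
  assumes sub: "mat_space.subspace S"
    and mult: "\<And>M N. M \<in> S \<Longrightarrow> N \<in> S \<Longrightarrow> mmul P M N \<in> S"
    and one: "kron (mone (ksub v k)) (mone (ksub v k)) \<in> S"
    and adj: "kron (johnson_adj v k) (mone (ksub v k)) + kron (mone (ksub v k)) (johnson_adj v k) \<in> S"
    and two: "kron (johnson_adj v k) (johnson_adj v k)
       + (kron (dist_two v k) (mone (ksub v k)) + kron (mone (ksub v k)) (dist_two v k)) \<in> S"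
  shows "kron (mat_poly (ksub v k) (johnson_adj v k) p) (mat_poly (ksub v k) (johnson_adj v k) q)
     + kron (mat_poly (ksub v k) (johnson_adj v k) q) (mat_poly (ksub v k) (johnson_adj v k) p) \<in> S"
proof -
  let ?I = "ksub v k" and ?A = "johnson_adj v k" and ?D = "dist_two v k"
  let ?p1 = "kron ?A (mone ?I) + kron (mone ?I) ?A"
  note one_left = mmul_mone_left[OF finite_ksub mats_mat_pow[OF mats_adj]]
  have pow1: "mat_pow ?I ?A (Suc 0) = ?A"
    by (simp add: mmul_mone_right[OF finite_ksub mats_adj])
  have e: "kron ?A ?A \<in> S"
  proof -
    obtain c0 c1 where sq: "mmul ?I ?A ?A = mscale c0 (mone ?I) + mscale c1 ?A + mscale 4 ?D"
      using adj_square[of v k] by blast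
    have "mmul P ?p1 ?p1 = kron (mmul ?I ?A ?A) (mone ?I) + kron (mone ?I) (mmul ?I ?A ?A)
        + (kron ?A ?A + kron ?A ?A)"
      unfolding P_def mmul_add_left mmul_add_right mmul_kron
      by (simp only: mmul_mone_left[OF finite_ksub mats_adj] mmul_mone_right[OF finite_ksub mats_adj]
        mmul_mone_left[OF finite_ksub mats_mone] add_ac)
    then have "kron ?A ?A = mscale 2 (kron ?A ?A + (kron ?D (mone ?I) + kron (mone ?I) ?D))
        + mscale (- 1 / 2) (mmul P ?p1 ?p1) + mscale c0 (kron (mone ?I) (mone ?I)) + mscale (c1 / 2) ?p1"
      unfolding sq by (simp add: fun_eq_iff mscale_def kron_def algebra_simps)
    moreover have "\<dots> \<in> S"
      by (intro mat_space.subspace_add[OF sub] mat_space.subspace_scale[OF sub] two one adj mult)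
    ultimately show ?thesis by simp
  qed
  have up: "mmul P ?p1 (sym_pow v k m n) = sym_pow v k (Suc m) n + sym_pow v k m (Suc n)" for m n
    unfolding P_def sym_pow_def mmul_add_left mmul_add_right mmul_kron one_left
    by (simp only: mat_pow.simps add_ac)
  have diag: "mmul P (kron ?A ?A) (sym_pow v k m n) = sym_pow v k (Suc m) (Suc n)" for m n
    unfolding P_def sym_pow_def mmul_add_right mmul_kron by (simp only: mat_pow.simps)
  have comm: "sym_pow v k m n = sym_pow v k n m" for m n
    unfolding sym_pow_def by (rule add.commute)
  \<comment> \<open>Newton's recursion for the power sums.\<close>
  have sym0: "sym_pow v k 0 n \<in> S \<and> sym_pow v k 0 (Suc n) \<in> S" for n
  proof (induction n rule: nat_less_induct)
    case (1 n)
    show ?case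
    proof (cases n)
      case 0
      have "sym_pow v k 0 0 = mscale 2 (kron (mone ?I) (mone ?I))"
        by (simp add: sym_pow_def mscale_def fun_eq_iff)
      then have "sym_pow v k 0 0 \<in> S" using one mat_space.subspace_scale[OF sub] by simp
      moreover have "sym_pow v k 0 (Suc 0) = ?p1"
        unfolding sym_pow_def pow1 by (simp only: mat_pow.simps add.commute)
      ultimately show ?thesis using 0 adj by (simp only:)
    next
      case (Suc l)
      have l: "sym_pow v k 0 l \<in> S" "sym_pow v k 0 (Suc l) \<in> S"
        using 1 Suc by auto
      have "mscale (- 1) (mmul P (kron ?A ?A) (sym_pow v k 0 l)) + mmul P ?p1 (sym_pow v k 0 (Suc l))
          = sym_pow v k 0 (Suc (Suc l))"
        unfolding up diag by (simp add: mscale_def fun_eq_iff)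
      moreover have "mscale (- 1) (mmul P (kron ?A ?A) (sym_pow v k 0 l)) + mmul P ?p1 (sym_pow v k 0 (Suc l)) \<in> S"
        by (intro mat_space.subspace_add[OF sub] mat_space.subspace_scale[OF sub] adj mult e l)
      ultimately show ?thesis using Suc l by simp
    qed
  qed
  have sym: "sym_pow v k m n \<in> S" for m n
  proof (induction m arbitrary: n)
    case 0
    then show ?case using sym0 by blast
  next
    case (Suc m)
    show ?case
    proof (cases n)
      case 0
      then show ?thesis using sym0 comm by metis
    next
      case (Suc l)
      then show ?thesis using mult[OF e Suc.IH[of l]] unfolding diag by simp
    qed
  qed
  have "kron (mat_poly ?I ?A p) (mat_poly ?I ?A q) + kron (mat_poly ?I ?A q) (mat_poly ?I ?A p)
      = (\<Sum>m\<le>degree p. \<Sum>n\<le>degree q. mscale (coeff p m * coeff q n) (sym_pow v k m n))"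
  proof -
    have 1: "kron (mat_poly ?I ?A p) (mat_poly ?I ?A q) = (\<Sum>m\<le>degree p. \<Sum>n\<le>degree q.
        mscale (coeff p m * coeff q n) (kron (mat_pow ?I ?A m) (mat_pow ?I ?A n)))"
      by (simp only: mat_poly_def kron_sum_sum)
    have 2: "kron (mat_poly ?I ?A q) (mat_poly ?I ?A p) = (\<Sum>m\<le>degree p. \<Sum>n\<le>degree q.
        mscale (coeff p m * coeff q n) (kron (mat_pow ?I ?A n) (mat_pow ?I ?A m)))"
      unfolding mat_poly_def kron_sum_sum by (subst sum.swap) (simp only: mult.commute)
    show ?thesis unfolding 1 2 sym_pow_def by (simp only: mat_space.scale_right_distrib sum.distrib)
  qed
  also have "\<dots> \<in> S"
    by (intro mat_space.subspace_sum[OF sub] mat_space.subspace_scale[OF sub] sym)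
  finally show ?thesis .
qed

section \<open>Orbits of pairs of subset pairs\<close>

lemma bij_betw_image_subset:
  assumes "finite V" "finite W" "card V = card W" "A \<subseteq> V" "B \<subseteq> W" "card A = card B"
  shows "\<exists>h. bij_betw h V W \<and> h ` A = B"
proof -
  have fin: "finite A" "finite B" using assms finite_subset by blast+
  obtain h1 where h1: "bij_betw h1 A B"
    using finite_same_card_bij[OF fin assms(6)] by blast
  have "card (V - A) = card (W - B)"
    using assms fin by (simp add: card_Diff_subset)
  then obtain h2 where h2: "bij_betw h2 (V - A) (W - B)"
    using finite_same_card_bij[of "V - A" "W - B"] assms(1,2) by blast
  let ?h = "\<lambda>t. if t \<in> A then h1 t else h2 t"
  have "bij_betw ?h (A \<union> (V - A)) (B \<union> (W - B))"
    by (rule bij_betw_disjoint_Un[OF h1 h2]) auto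
  moreover have "A \<union> (V - A) = V" "B \<union> (W - B) = W" using assms by auto
  moreover have "?h ` A = B"
    using bij_betw_imp_surj_on[OF h1] by (simp cong: image_cong)
  ultimately show ?thesis by (intro exI[of _ ?h]) simp
qed

text \<open>Two subsets of a finite set are determined up to a permutation by their sizes and the size of
  their intersection.\<close>

lemma perm_two_subsets:
  assumes V: "finite V" and sub: "a \<subseteq> V" "b \<subseteq> V" "a' \<subseteq> V" "b' \<subseteq> V"
    and card: "card a = card a'" "card b = card b'" "card (a \<inter> b) = card (a' \<inter> b')"
  shows "\<exists>h. bij_betw h V V \<and> h ` a = a' \<and> h ` b = b'"
proof -
  have fin: "finite a" "finite b" "finite a'" "finite b'" using sub V finite_subset by blast+
  obtain h1 where h1: "bij_betw h1 a a'" "h1 ` (a \<inter> b) = a' \<inter> b'"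
    using bij_betw_image_subset[of a a' "a \<inter> b" "a' \<inter> b'"] fin card by auto
  have "card (V - a) = card (V - a')"
    using sub fin card by (simp add: card_Diff_subset)
  moreover have "card (b - a) = card (b' - a')"
    using card_Diff_subset_Int[of b a] card_Diff_subset_Int[of b' a'] fin card
    by (simp add: Int_commute)
  ultimately obtain h2 where h2: "bij_betw h2 (V - a) (V - a')" "h2 ` (b - a) = b' - a'"
    using bij_betw_image_subset[of "V - a" "V - a'" "b - a" "b' - a'"] V sub
    by (metis Diff_mono finite_Diff order_refl)
  let ?h = "\<lambda>t. if t \<in> a then h1 t else h2 t"
  have "bij_betw ?h (a \<union> (V - a)) (a' \<union> (V - a'))"
    by (rule bij_betw_disjoint_Un[OF h1(1) h2(1)]) auto
  moreover have "a \<union> (V - a) = V" "a' \<union> (V - a') = V" using sub by auto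
  moreover have "?h ` a = a'"
    using bij_betw_imp_surj_on[OF h1(1)] by (simp cong: image_cong)
  moreover have "?h ` b = b'"
  proof -
    have "?h ` b = ?h ` (a \<inter> b) \<union> ?h ` (b - a)" by auto
    also have "?h ` (a \<inter> b) = h1 ` (a \<inter> b)" by (rule image_cong) auto
    also have "?h ` (b - a) = h2 ` (b - a)" by (rule image_cong) auto
    also have "h1 ` (a \<inter> b) \<union> h2 ` (b - a) = (a' \<inter> b') \<union> (b' - a')" by (simp only: h1(2) h2(2))
    finally show ?thesis by auto
  qed
  ultimately show ?thesis by (intro exI[of _ ?h]) simp
qed

text \<open>The index set: pairs of subsets of \<open>{1..d}\<close> of the same size. They encode the \<open>d\<close>-subsets
  of \<open>{1..2d}\<close> by their differences with \<open>x\<close>.\<close>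

definition eqpairs :: "nat \<Rightarrow> (nat set \<times> nat set) set" where
  "eqpairs d = {(a, b). a \<subseteq> {1..d} \<and> b \<subseteq> {1..d} \<and> card a = card b}"

text \<open>The invariant of a pair of indices under the permutations of the two copies of \<open>{1..d}\<close> and
  the exchange of the copies.\<close>

fun orb_type :: "nat set \<times> nat set \<Rightarrow> nat set \<times> nat set \<Rightarrow> nat \<times> nat \<times> nat set" where
  "orb_type (a, b) (a', b') = (card a, card a', {card (a \<inter> a'), card (b \<inter> b')})"

lemma perm_image:
  assumes h: "bij_betw h V V"
  shows "bij_betw ((`) h) (Pow V) (Pow V)"
    and "c \<subseteq> V \<Longrightarrow> card (h ` c) = card c"
    and "c \<subseteq> V \<Longrightarrow> e \<subseteq> V \<Longrightarrow> card (h ` c \<inter> h ` e) = card (c \<inter> e)"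
proof -
  have inj: "inj_on h V" using h by (simp add: bij_betw_def)
  show "bij_betw ((`) h) (Pow V) (Pow V)" by (rule bij_betw_Pow[OF h])
  show c: "card (h ` c) = card c" if "c \<subseteq> V" for c
    using that inj by (meson card_image inj_on_subset)
  show "card (h ` c \<inter> h ` e) = card (c \<inter> e)" if "c \<subseteq> V" "e \<subseteq> V"
    using inj_on_image_Int[OF inj that] c[of "c \<inter> e"] that by auto
qed

text \<open>Pairs of indices with the same invariant are related by a permutation \<open>\<phi>\<close> of the index set that
  preserves the invariants: two permutations of \<open>{1..d}\<close> acting on the components, followed by the
  exchange of the components if the intersection sizes are exchanged. Only the effect of \<open>\<phi>\<close> on the
  types seen from the two given pairs is recorded.\<close>

lemma orb_type_transfer:
  assumes mem: "u \<in> eqpairs d" "v \<in> eqpairs d" "u' \<in> eqpairs d" "v' \<in> eqpairs d"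
    and eq: "orb_type u v = orb_type u' v'"
  shows "\<exists>\<phi>. bij_betw \<phi> (eqpairs d) (eqpairs d)
     \<and> (\<forall>w\<in>eqpairs d. orb_type u w = orb_type u' (\<phi> w) \<and> orb_type w v = orb_type (\<phi> w) v')"
proof -
  let ?V = "{1..d}"
  obtain a b where u: "u = (a, b)" by (cases u)
  obtain e c where v: "v = (e, c)" by (cases v)
  obtain a' b' where u': "u' = (a', b')" by (cases u')
  obtain e' c' where v': "v' = (e', c')" by (cases v')
  have sub: "a \<subseteq> ?V" "b \<subseteq> ?V" "e \<subseteq> ?V" "c \<subseteq> ?V" "a' \<subseteq> ?V" "b' \<subseteq> ?V" "e' \<subseteq> ?V" "c' \<subseteq> ?V"
    and cards: "card a = card b" "card e = card c" "card a' = card b'" "card e' = card c'"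
    using mem unfolding u v u' v' eqpairs_def by (simp_all only: mem_Collect_eq prod.case)
  have cards': "card a = card a'" "card e = card e'"
    and dbl: "{card (a \<inter> e), card (b \<inter> c)} = {card (a' \<inter> e'), card (b' \<inter> c')}"
    using eq unfolding u v u' v' by (simp_all only: orb_type.simps prod.inject)
  have card_perm: "bij_betw (\<lambda>(s, t). (h ` s, k ` t)) (eqpairs d) (eqpairs d)"
    if "bij_betw h ?V ?V" "bij_betw k ?V ?V" for h k
  proof -
    let ?F = "\<lambda>(s, t). (h ` s, k ` t)"
    have "inj_on ((`) h) (Pow ?V)" "inj_on ((`) k) (Pow ?V)"
      using perm_image(1)[OF that(1)] perm_image(1)[OF that(2)] by (simp_all only: bij_betw_def)
    then have "inj_on ?F (Pow ?V \<times> Pow ?V)"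
      using map_prod_inj_on[of "(`) h" "Pow ?V" "(`) k" "Pow ?V"] by (simp only: map_prod_def)
    moreover have "eqpairs d \<subseteq> Pow ?V \<times> Pow ?V" unfolding eqpairs_def by auto
    ultimately have inj: "inj_on ?F (eqpairs d)" by (rule inj_on_subset)
    have "?F ` eqpairs d \<subseteq> eqpairs d"
    proof (rule image_subsetI)
      fix w assume "w \<in> eqpairs d"
      then obtain s t where w: "w = (s, t)" "s \<subseteq> ?V" "t \<subseteq> ?V" "card s = card t"
        unfolding eqpairs_def by auto
      have "h ` s \<subseteq> ?V" "k ` t \<subseteq> ?V"
        using w(2,3) bij_betw_imp_surj_on[OF that(1)] bij_betw_imp_surj_on[OF that(2)] by blast+
      moreover have "card (h ` s) = card (k ` t)"
        by (simp only: perm_image(2)[OF that(1) w(2)] perm_image(2)[OF that(2) w(3)] w(4))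
      ultimately show "?F w \<in> eqpairs d" unfolding w(1) eqpairs_def by simp
    qed
    moreover have "finite (eqpairs d)"
      by (rule finite_subset[OF \<open>eqpairs d \<subseteq> Pow ?V \<times> Pow ?V\<close>]) simp
    ultimately show ?thesis
      unfolding bij_betw_def using inj endo_inj_surj by blast
  qed
  have swap: "bij_betw prod.swap (eqpairs d) (eqpairs d)"
    by (rule bij_betw_byWitness[where f' = prod.swap]) (auto simp: eqpairs_def)
  from dbl consider
      (straight) "card (a \<inter> e) = card (a' \<inter> e')" "card (b \<inter> c) = card (b' \<inter> c')"
    | (cross) "card (a \<inter> e) = card (b' \<inter> c')" "card (b \<inter> c) = card (a' \<inter> e')"
    unfolding doubleton_eq_iff by blast
  then show ?thesis
  proof cases
    case straight
    obtain h where h: "bij_betw h ?V ?V" "h ` a = a'" "h ` e = e'"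
      using perm_two_subsets[OF finite_atLeastAtMost sub(1,3,5,7) cards' straight(1)] by blast
    obtain k where k: "bij_betw k ?V ?V" "k ` b = b'" "k ` c = c'"
      using perm_two_subsets[OF finite_atLeastAtMost sub(2,4,6,8) _ _ straight(2)] cards cards' by metis
    have "orb_type u w = orb_type u' (case w of (s, t) \<Rightarrow> (h ` s, k ` t))
        \<and> orb_type w v = orb_type (case w of (s, t) \<Rightarrow> (h ` s, k ` t)) v'"
      if wmem: "w \<in> eqpairs d" for w
    proof -
      obtain s t where w: "w = (s, t)" "s \<subseteq> ?V" "t \<subseteq> ?V" "card s = card t"
        using wmem unfolding eqpairs_def by auto
      have "card (a' \<inter> h ` s) = card (a \<inter> s)" "card (h ` s \<inter> e') = card (s \<inter> e)"
        "card (b' \<inter> k ` t) = card (b \<inter> t)" "card (k ` t \<inter> c') = card (t \<inter> c)"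
        unfolding h(2,3)[symmetric] k(2,3)[symmetric]
        using sub w(2,3) by (intro perm_image(3)[OF h(1)] perm_image(3)[OF k(1)]; simp)+
      then show ?thesis
        unfolding u v u' v' w(1) by (simp add: perm_image(2)[OF h(1) w(2)] cards')
    qed
    then show ?thesis using card_perm[OF h(1) k(1)] by blast
  next
    case cross
    obtain h where h: "bij_betw h ?V ?V" "h ` a = b'" "h ` e = c'"
      using perm_two_subsets[OF finite_atLeastAtMost sub(1,3,6,8) _ _ cross(1)] cards cards' by metis
    obtain k where k: "bij_betw k ?V ?V" "k ` b = a'" "k ` c = e'"
      using perm_two_subsets[OF finite_atLeastAtMost sub(2,4,5,7) _ _ cross(2)] cards cards' by metis
    let ?\<phi> = "prod.swap \<circ> (\<lambda>(s, t). (h ` s, k ` t))"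
    have "orb_type u w = orb_type u' (?\<phi> w) \<and> orb_type w v = orb_type (?\<phi> w) v'"
      if wmem: "w \<in> eqpairs d" for w
    proof -
      obtain s t where w: "w = (s, t)" "s \<subseteq> ?V" "t \<subseteq> ?V" "card s = card t"
        using wmem unfolding eqpairs_def by auto
      have "card (b' \<inter> h ` s) = card (a \<inter> s)" "card (h ` s \<inter> c') = card (s \<inter> e)"
        "card (a' \<inter> k ` t) = card (b \<inter> t)" "card (k ` t \<inter> e') = card (t \<inter> c)"
        unfolding h(2,3)[symmetric] k(2,3)[symmetric]
        using sub w(2,3) by (intro perm_image(3)[OF h(1)] perm_image(3)[OF k(1)]; simp)+
      then show ?thesis
        unfolding u v u' v' w(1)
        by (simp add: perm_image(2)[OF k(1) w(3)] w(4) cards' insert_commute)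
    qed
    moreover have "bij_betw ?\<phi> (eqpairs d) (eqpairs d)"
      by (rule bij_betw_trans[OF card_perm[OF h(1) k(1)] swap])
    ultimately show ?thesis by blast
  qed
qed


section \<open>Coordinates relative to the base vertex\<close>

text \<open>A base vertex with bijections from it and from its complement onto \<open>{1..d}\<close>.\<close>

locale base_vertex =
  fixes d :: nat and x :: "nat set" and f g :: "nat \<Rightarrow> nat"
  assumes x: "x \<in> ksub (2 * d) d"
    and f: "bij_betw f x {1..d}"
    and g: "bij_betw g ({1..2 * d} - x) {1..d}"
begin

abbreviation X :: "nat set set" where "X \<equiv> ksub (2 * d) d"

text \<open>The coordinates of a vertex. The first one is taken from \<open>x - y\<close> instead of \<open>x \<inter> y\<close>, so that
  both have the same size \<open>i\<close> on the \<open>i\<close>-th subconstituent and the exchange of the coordinates makes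
  sense; it is the complement of the first component of \<open>split_set\<close>.\<close>

definition coords :: "nat set \<Rightarrow> nat set \<times> nat set" where
  "coords y = (f ` (x - y), g ` (y - x))"

lemma inj_f: "inj_on f x" and inj_g: "inj_on g ({1..2 * d} - x)"
  using f g by (auto simp: bij_betw_def)

lemma card_coords:
  assumes "y \<in> X"
  shows "card (f ` (x - y)) + card (x \<inter> y) = d" "card (g ` (y - x)) + card (x \<inter> y) = d"
proof -
  have fin: "finite x" "finite y" "card x = d" "card y = d" "y \<subseteq> {1..2 * d}"
    using x assms ksub_finite[OF x] ksub_finite[OF assms] by (simp_all add: ksub_def)
  have "card (f ` (x - y)) = card (x - y)"
    by (rule card_image[OF inj_on_subset[OF inj_f]]) auto
  moreover have "card (g ` (y - x)) = card (y - x)"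
    by (rule card_image[OF inj_on_subset[OF inj_g]]) (use fin in auto)
  moreover have "card (x \<inter> y) \<le> d" by (rule card_Int_le[OF x])
  ultimately show "card (f ` (x - y)) + card (x \<inter> y) = d" "card (g ` (y - x)) + card (x \<inter> y) = d"
    using card_Diff_subset_Int[of x y] card_Diff_subset_Int[of y x] fin
    by (simp_all add: Int_commute)
qed

lemma coords_in:
  assumes "y \<in> X" shows "coords y \<in> eqpairs d"
proof -
  have "card (f ` (x - y)) = card (g ` (y - x))"
    using card_coords[OF assms] by linarith
  moreover have "f ` (x - y) \<subseteq> {1..d}"
    using bij_betw_imp_surj_on[OF f] by blast
  moreover have "y - x \<subseteq> {1..2 * d} - x" using assms by (auto simp: ksub_def)
  then have "g ` (y - x) \<subseteq> {1..d}"
    using bij_betw_imp_surj_on[OF g] by blast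
  ultimately show ?thesis unfolding coords_def eqpairs_def by simp
qed

lemma bij_coords: "bij_betw coords X (eqpairs d)"
proof -
  have "inj_on coords X"
  proof (rule inj_onI)
    fix y z assume yz: "y \<in> X" "z \<in> X" and eq: "coords y = coords z"
    have "x - y = x - z"
      using eq inj_on_image_eq_iff[OF inj_f, of "x - y" "x - z"] unfolding coords_def by auto
    moreover have "y - x \<subseteq> {1..2 * d} - x" "z - x \<subseteq> {1..2 * d} - x"
      using yz by (auto simp: ksub_def)
    then have "y - x = z - x"
      using eq inj_on_image_eq_iff[OF inj_g, of "y - x" "z - x"] unfolding coords_def by auto
    ultimately show "y = z" by blast
  qed
  moreover have "w \<in> coords ` X" if w: "w \<in> eqpairs d" for w
  proof -
    obtain a b where ab: "w = (a, b)" "a \<subseteq> {1..d}" "b \<subseteq> {1..d}" "card a = card b"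
      using w unfolding eqpairs_def by auto
    define a' where "a' = {t \<in> x. f t \<in> a}"
    define b' where "b' = {t \<in> {1..2 * d} - x. g t \<in> b}"
    have "a \<subseteq> f ` x" "b \<subseteq> g ` ({1..2 * d} - x)"
      using ab(2,3) by (simp_all only: bij_betw_imp_surj_on[OF f] bij_betw_imp_surj_on[OF g])
    then have im: "f ` a' = a" "g ` b' = b"
      unfolding a'_def b'_def by blast+
    have sub': "a' \<subseteq> x" "b' \<subseteq> {1..2 * d} - x" unfolding a'_def b'_def by blast+
    have "card a' = card a"
      using card_image[OF inj_on_subset[OF inj_f sub'(1)]] im by simp
    moreover have "card b' = card b"
      using card_image[OF inj_on_subset[OF inj_g sub'(2)]] im by simp
    moreover have fx: "finite x" "card x = d" "x \<subseteq> {1..2 * d}"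
      using x ksub_finite[OF x] by (simp_all add: ksub_def)
    moreover have "card (x - a') = card x - card a'" "card a' \<le> card x"
      using fx by (auto simp: a'_def intro!: card_Diff_subset card_mono)
    moreover have "card ((x - a') \<union> b') = card (x - a') + card b'"
      using fx by (intro card_Un_disjoint) (auto simp: b'_def)
    ultimately have "(x - a') \<union> b' \<in> X"
      using ab(4) fx by (auto simp: ksub_def b'_def)
    moreover have "x - ((x - a') \<union> b') = a'" "((x - a') \<union> b') - x = b'"
      unfolding a'_def b'_def by auto
    then have "coords ((x - a') \<union> b') = w"
      unfolding coords_def ab(1) by (simp add: im)
    ultimately show ?thesis by blast
  qed
  ultimately show ?thesis
    unfolding bij_betw_def using coords_in by blast
qed

lemma block_iff_coords:
  assumes "y \<in> X" "i \<le> d"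
  shows "y \<in> block d x i \<longleftrightarrow> coords y \<in> ksub d i \<times> ksub d i"
proof -
  have "card (x \<inter> y) = d - i \<longleftrightarrow> card (f ` (x - y)) = i \<and> card (g ` (y - x)) = i"
    using card_coords[OF assms(1)] assms(2) by linarith
  then show ?thesis
    using coords_in[OF assms(1)] assms(1) unfolding coords_def block_def eqpairs_def ksub_def by auto
qed

lemma rel_iff_block: "(x, y) \<in> johnson_rel d i \<longleftrightarrow> y \<in> block d x i"
  using x unfolding johnson_rel_def block_def by auto

lemma block_sub: "y \<in> block d x i \<Longrightarrow> y \<in> X"
  unfolding block_def by auto

lemma card_Int_coords:
  assumes "y \<in> X" "z \<in> X" "coords y = (a, b)" "coords z = (a', b')"
  shows "card (y \<inter> z) + card a + card a' = d + card (a \<inter> a') + card (b \<inter> b')"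
proof -
  have fin: "finite x" "card x = d" using x ksub_finite[OF x] by (simp_all add: ksub_def)
  have fy: "finite y" "y \<subseteq> {1..2 * d}" using assms(1) ksub_finite[OF assms(1)] by (simp_all add: ksub_def)
  have fz: "finite z" "z \<subseteq> {1..2 * d}" using assms(2) ksub_finite[OF assms(2)] by (simp_all add: ksub_def)
  have ab: "a = f ` (x - y)" "b = g ` (y - x)" "a' = f ` (x - z)" "b' = g ` (z - x)"
    using assms unfolding coords_def by auto
  have cf: "card (f ` s) = card s" if "s \<subseteq> x" for s
    by (rule card_image[OF inj_on_subset[OF inj_f that]])
  have "a \<inter> a' = f ` ((x - y) \<inter> (x - z))"
    unfolding ab by (rule inj_on_image_Int[OF inj_f, symmetric]) auto
  then have 1: "card (a \<inter> a') = card ((x - y) \<inter> (x - z))"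
    by (simp only:) (rule cf, blast)
  have "b \<inter> b' = g ` ((y - x) \<inter> (z - x))"
    unfolding ab by (rule inj_on_image_Int[OF inj_g, symmetric]) (use fy fz in auto)
  moreover have "card (g ` ((y - x) \<inter> (z - x))) = card ((y - x) \<inter> (z - x))"
    by (rule card_image[OF inj_on_subset[OF inj_g]]) (use fy in auto)
  ultimately have 2: "card (b \<inter> b') = card ((y - x) \<inter> (z - x))" by simp
  have 3: "card ((x - y) \<union> (x - z)) + card ((x - y) \<inter> (x - z)) = card (x - y) + card (x - z)"
    using card_Un_Int[of "x - y" "x - z"] fin by simp
  have "x = (x \<inter> y \<inter> z) \<union> ((x - y) \<union> (x - z))" by blast
  then have "card x = card (x \<inter> y \<inter> z) + card ((x - y) \<union> (x - z))"
    using fin card_Un_disjoint[of "x \<inter> y \<inter> z" "(x - y) \<union> (x - z)"] by auto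
  moreover have "y \<inter> z = (x \<inter> y \<inter> z) \<union> ((y - x) \<inter> (z - x))" by blast
  then have "card (y \<inter> z) = card (x \<inter> y \<inter> z) + card ((y - x) \<inter> (z - x))"
    using fy card_Un_disjoint[of "x \<inter> y \<inter> z" "(y - x) \<inter> (z - x)"] by auto
  ultimately show ?thesis
    using 1 2 3 cf[of "x - y"] cf[of "x - z"] fin unfolding ab by auto
qed

section \<open>The Terwilliger algebra lies in the block space\<close>

text \<open>The matrices on \<open>X\<close> that are constant on the pairs of vertices with the same invariant.\<close>

definition orbit_algebra :: "(nat set, nat set) cmatrix set" where
  "orbit_algebra = {M \<in> mats X X. \<forall>y\<in>X. \<forall>z\<in>X. \<forall>y'\<in>X. \<forall>z'\<in>X.
     orb_type (coords y) (coords z) = orb_type (coords y') (coords z') \<longrightarrow> M y z = M y' z'}"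

lemma orbit_algebraD:
  assumes "M \<in> orbit_algebra" "y \<in> X" "z \<in> X" "y' \<in> X" "z' \<in> X"
    and "orb_type (coords y) (coords z) = orb_type (coords y') (coords z')"
  shows "M y z = M y' z'"
  using assms unfolding orbit_algebra_def by blast

lemma orbit_algebra_mats: "M \<in> orbit_algebra \<Longrightarrow> M \<in> mats X X"
  unfolding orbit_algebra_def by blast

lemma orbit_algebraI:
  assumes "M \<in> mats X X"
    and "\<And>y z y' z'. y \<in> X \<Longrightarrow> z \<in> X \<Longrightarrow> y' \<in> X \<Longrightarrow> z' \<in> X
      \<Longrightarrow> orb_type (coords y) (coords z) = orb_type (coords y') (coords z') \<Longrightarrow> M y z = M y' z'"
  shows "M \<in> orbit_algebra"
  unfolding orbit_algebra_def using assms by blast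

lemma orbit_algebra_mmul:
  assumes M: "M \<in> orbit_algebra" and N: "N \<in> orbit_algebra"
  shows "mmul X M N \<in> orbit_algebra"
proof (rule orbit_algebraI)
  show "mmul X M N \<in> mats X X"
    using orbit_algebra_mats[OF M] orbit_algebra_mats[OF N] by (rule mats_mmul)
next
  fix y z y' z'
  assume mem: "y \<in> X" "z \<in> X" "y' \<in> X" "z' \<in> X"
    and eq: "orb_type (coords y) (coords z) = orb_type (coords y') (coords z')"
  obtain \<phi> where \<phi>: "bij_betw \<phi> (eqpairs d) (eqpairs d)"
    "\<And>w. w \<in> eqpairs d \<Longrightarrow> orb_type (coords y) w = orb_type (coords y') (\<phi> w)"
    "\<And>w. w \<in> eqpairs d \<Longrightarrow> orb_type w (coords z) = orb_type (\<phi> w) (coords z')"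
    using orb_type_transfer[OF coords_in[OF mem(1)] coords_in[OF mem(2)] coords_in[OF mem(3)]
        coords_in[OF mem(4)] eq] by blast
  \<comment> \<open>The permutation of the vertices that corresponds to \<open>\<phi>\<close> reindexes the sum over the middle vertex.\<close>
  define \<psi> where "\<psi> = inv_into X coords \<circ> (\<phi> \<circ> coords)"
  have \<psi>: "bij_betw \<psi> X X"
    unfolding \<psi>_def
    by (intro bij_betw_trans[of _ X "eqpairs d"] bij_betw_trans[of _ X "eqpairs d"]
        bij_betw_inv_into bij_coords \<phi>(1))
  have "M y w * N w z = M y' (\<psi> w) * N (\<psi> w) z'" if w: "w \<in> X" for w
  proof -
    have "\<phi> (coords w) \<in> eqpairs d"
      by (rule bij_betwE[OF \<phi>(1), rule_format, OF coords_in[OF w]])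
    then have c: "coords (\<psi> w) = \<phi> (coords w)"
      unfolding \<psi>_def comp_apply by (rule bij_betw_inv_into_right[OF bij_coords])
    have X: "\<psi> w \<in> X" by (rule bij_betwE[OF \<psi>, rule_format, OF w])
    have "M y w = M y' (\<psi> w)"
      by (rule orbit_algebraD[OF M mem(1) w mem(3) X]) (simp only: c \<phi>(2)[OF coords_in[OF w]])
    moreover have "N w z = N (\<psi> w) z'"
      by (rule orbit_algebraD[OF N w mem(2) X mem(4)]) (simp only: c \<phi>(3)[OF coords_in[OF w]])
    ultimately show ?thesis by simp
  qed
  then have "(\<Sum>w\<in>X. M y w * N w z) = (\<Sum>w\<in>X. M y' (\<psi> w) * N (\<psi> w) z')"
    by (intro sum.cong) auto
  also have "\<dots> = (\<Sum>w\<in>X. M y' w * N w z')"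
    by (rule sum.reindex_bij_betw[OF \<psi>])
  finally show "mmul X M N y z = mmul X M N y' z'" unfolding mmul_def .
qed

text \<open>Equality of vertices is visible in the invariant, which makes the diagonal generators and the
  identity members of the orbit algebra.\<close>

lemma orb_type_eq_iff:
  assumes "y \<in> X" "z \<in> X"
  shows "y = z \<longleftrightarrow> orb_type (coords y) (coords z) = (card (x - y), card (x - y), {card (x - y)})"
proof -
  obtain a b where y: "coords y = (a, b)" by (cases "coords y")
  obtain a' b' where z: "coords z = (a', b')" by (cases "coords z")
  have sub: "a \<subseteq> {1..d}" "b \<subseteq> {1..d}" "a' \<subseteq> {1..d}" "b' \<subseteq> {1..d}" "card a = card b" "card a' = card b'"
    using coords_in[OF assms(1)] coords_in[OF assms(2)] unfolding y z eqpairs_def by auto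
  then have fin: "finite a" "finite b" "finite a'" "finite b'" using finite_subset by blast+
  have "card (f ` (x - y)) = card (x - y)"
    by (rule card_image[OF inj_on_subset[OF inj_f]]) blast
  then have a: "card (x - y) = card a"
    using y unfolding coords_def by (simp only: prod.inject)
  have eq: "s = t" if "finite s" "finite t" "card s = card t" "card (s \<inter> t) = card s" for s t :: "nat set"
  proof -
    have "s \<inter> t = s" by (rule card_subset_eq[OF that(1)]) (use that in auto)
    moreover have "s \<inter> t = t" by (rule card_subset_eq[OF that(2)]) (use that in auto)
    ultimately show ?thesis by simp
  qed
  have "y = z \<longleftrightarrow> (a, b) = (a', b')"
    using inj_on_eq_iff[OF bij_betw_imp_inj_on[OF bij_coords] assms] y z by simp
  also have "\<dots> \<longleftrightarrow> card a' = card a \<and> card (a \<inter> a') = card a \<and> card (b \<inter> b') = card a"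
  proof
    assume "(a, b) = (a', b')"
    then show "card a' = card a \<and> card (a \<inter> a') = card a \<and> card (b \<inter> b') = card a"
      using sub(5) by (intro conjI) (simp_all only: prod.inject Int_absorb)
  next
    assume *: "card a' = card a \<and> card (a \<inter> a') = card a \<and> card (b \<inter> b') = card a"
    then have "card b = card b'" "card (b \<inter> b') = card b" using sub(5,6) by linarith+
    then show "(a, b) = (a', b')" using eq[OF fin(1,3)] eq[OF fin(2,4)] * by metis
  qed
  also have "\<dots> \<longleftrightarrow> orb_type (coords y) (coords z) = (card (x - y), card (x - y), {card (x - y)})"
    unfolding y z a orb_type.simps prod.inject by blast
  finally show ?thesis .
qed

lemma orb_type_card_Int:
  assumes mem: "y \<in> X" "z \<in> X" "y' \<in> X" "z' \<in> X"
    and eq: "orb_type (coords y) (coords z) = orb_type (coords y') (coords z')"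
  shows "card (y \<inter> z) = card (y' \<inter> z')" "card (x - y) = card (x - y')" "y = z \<longleftrightarrow> y' = z'"
proof -
  obtain a b where y: "coords y = (a, b)" by (cases "coords y")
  obtain c e where z: "coords z = (c, e)" by (cases "coords z")
  obtain a' b' where y': "coords y' = (a', b')" by (cases "coords y'")
  obtain c' e' where z': "coords z' = (c', e')" by (cases "coords z'")
  have "card a = card a'" "card c = card c'"
    "card (a \<inter> c) + card (b \<inter> e) = card (a' \<inter> c') + card (b' \<inter> e')"
    using eq unfolding y z y' z' by (auto simp: doubleton_eq_iff)
  then show "card (y \<inter> z) = card (y' \<inter> z')"
    using card_Int_coords[OF mem(1,2) y z] card_Int_coords[OF mem(3,4) y' z'] by linarith
  have "card (x - t) = card (fst (coords t))" for t
    using card_image[OF inj_on_subset[OF inj_f], of "x - t"] unfolding coords_def by auto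
  then show xy: "card (x - y) = card (x - y')"
    using \<open>card a = card a'\<close> y y' by simp
  show "y = z \<longleftrightarrow> y' = z'"
    using orb_type_eq_iff[OF mem(1,2)] orb_type_eq_iff[OF mem(3,4)] xy eq by simp
qed

lemma orbit_algebra_subalgebra: "is_subalgebra X orbit_algebra"
  unfolding is_subalgebra_def
proof (intro conjI ballI)
  show "orbit_algebra \<subseteq> mats X X" unfolding orbit_algebra_def by blast
  show "mat_space.subspace orbit_algebra"
  proof (rule mat_space.subspaceI)
    show "0 \<in> orbit_algebra" by (rule orbit_algebraI) (simp_all add: mats_zero)
    show "M + N \<in> orbit_algebra" if "M \<in> orbit_algebra" "N \<in> orbit_algebra" for M N
    proof (rule orbit_algebraI)
      show "M + N \<in> mats X X" using that by (intro mats_add orbit_algebra_mats)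
      show "(M + N) y z = (M + N) y' z'"
        if "y \<in> X" "z \<in> X" "y' \<in> X" "z' \<in> X"
          "orb_type (coords y) (coords z) = orb_type (coords y') (coords z')" for y z y' z'
        using orbit_algebraD[OF \<open>M \<in> orbit_algebra\<close> that] orbit_algebraD[OF \<open>N \<in> orbit_algebra\<close> that]
        by (simp only: plus_fun_apply)
    qed
    show "mscale c M \<in> orbit_algebra" if "M \<in> orbit_algebra" for c M
    proof (rule orbit_algebraI)
      show "mscale c M \<in> mats X X" using that by (intro mats_mscale orbit_algebra_mats)
      show "mscale c M y z = mscale c M y' z'"
        if "y \<in> X" "z \<in> X" "y' \<in> X" "z' \<in> X"
          "orb_type (coords y) (coords z) = orb_type (coords y') (coords z')" for y z y' z'
        using orbit_algebraD[OF \<open>M \<in> orbit_algebra\<close> that] by (simp only: mscale_apply)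
    qed
  qed
  show "mone X \<in> orbit_algebra"
  proof (rule orbit_algebraI[OF mats_mone])
    fix y z y' z'
    assume mem: "y \<in> X" "z \<in> X" "y' \<in> X" "z' \<in> X"
      and eq: "orb_type (coords y) (coords z) = orb_type (coords y') (coords z')"
    show "mone X y z = mone X y' z'"
      unfolding mone_def using orb_type_card_Int(3)[OF mem eq] mem by (simp only: simp_thms)
  qed
  show "mmul X M N \<in> orbit_algebra" if "M \<in> orbit_algebra" "N \<in> orbit_algebra" for M N
    using that by (rule orbit_algebra_mmul)
qed

lemma terwilliger_sub_orbit: "terwilliger d x \<subseteq> orbit_algebra"
  unfolding terwilliger_def
proof (rule hull_minimal[where S = "is_subalgebra X", OF _ orbit_algebra_subalgebra])
  have "assoc_mat d i \<in> orbit_algebra" for i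
  proof (rule orbit_algebraI)
    show "assoc_mat d i \<in> mats X X" by (auto simp: mats_def assoc_mat_def johnson_rel_def)
    fix y z y' z'
    assume mem: "y \<in> X" "z \<in> X" "y' \<in> X" "z' \<in> X"
      and eq: "orb_type (coords y) (coords z) = orb_type (coords y') (coords z')"
    show "assoc_mat d i y z = assoc_mat d i y' z'"
      using mem orb_type_card_Int(1)[OF mem eq] by (simp add: assoc_mat_def johnson_rel_def)
  qed
  moreover have "dual_idem d x i \<in> orbit_algebra" for i
  proof (rule orbit_algebraI)
    show "dual_idem d x i \<in> mats X X" by (auto simp: mats_def dual_idem_def johnson_rel_def)
    fix y z y' z'
    assume mem: "y \<in> X" "z \<in> X" "y' \<in> X" "z' \<in> X"
      and eq: "orb_type (coords y) (coords z) = orb_type (coords y') (coords z')"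
    have fx: "finite x" "card x = d" using x ksub_finite[OF x] by (simp_all add: ksub_def)
    have "card (x - y) + card (x \<inter> y) = d" "card (x - y') + card (x \<inter> y') = d"
      using card_Int_Diff[OF fx(1), of y] card_Int_Diff[OF fx(1), of y'] fx(2) by simp_all
    then have "card (x \<inter> y) = card (x \<inter> y')"
      using orb_type_card_Int(2)[OF mem eq] by linarith
    then show "dual_idem d x i y z = dual_idem d x i y' z'"
      using orb_type_card_Int(3)[OF mem eq] mem x by (simp add: dual_idem_def johnson_rel_def)
  qed
  ultimately show "assoc_mat d ` {0..d} \<union> dual_idem d x ` {0..d} \<subseteq> orbit_algebra" by blast
qed

lemma split_set_coords: "split_set x f g y = ({1..d} - fst (coords y), snd (coords y))"
proof -
  have "f ` (y \<inter> x) = f ` (x - (x - y))" by (rule arg_cong[of _ _ "\<lambda>s. f ` s"]) blast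
  also have "\<dots> = {1..d} - f ` (x - y)"
    using inj_on_image_set_diff[OF inj_f, of x "x - y"] bij_betw_imp_surj_on[OF f] by auto
  finally show ?thesis unfolding split_set_def coords_def by simp
qed

lemma orbit_sub_N_total: "orbit_algebra \<subseteq> N_total d x f g"
proof
  fix M assume M: "M \<in> orbit_algebra"
  \<comment> \<open>The common value of the entries of \<open>M\<close> with invariant \<open>(i, j, {p, q})\<close>.\<close>
  define \<Phi> where "\<Phi> i j p q = (THE c. \<forall>y\<in>X. \<forall>z\<in>X. orb_type (coords y) (coords z) = (i, j, {p, q}) \<longrightarrow> M y z = c)"
    for i j p q
  have \<Phi>: "\<Phi> i j p q = M y z" if "y \<in> X" "z \<in> X" "orb_type (coords y) (coords z) = (i, j, {p, q})" for i j p q y z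
    unfolding \<Phi>_def
  proof (rule the_equality)
    show "\<forall>y'\<in>X. \<forall>z'\<in>X. orb_type (coords y') (coords z') = (i, j, {p, q}) \<longrightarrow> M y' z' = M y z"
      using orbit_algebraD[OF M _ _ that(1,2)] that(3) by simp
  qed (use that in blast)
  have sym: "\<Phi> i j p q = \<Phi> i j q p" for i j p q
    unfolding \<Phi>_def by (simp add: insert_commute)
  have "\<exists>Y. Y \<in> N_space d i j \<and> (\<forall>a b a' b'. a \<in> ksub d i \<longrightarrow> b \<in> ksub d i \<longrightarrow> a' \<in> ksub d j \<longrightarrow> b' \<in> ksub d j
       \<longrightarrow> Y ({1..d} - a, b) ({1..d} - a', b') = \<Phi> i j (card (a \<inter> a')) (card (b \<inter> b')))"
    if "i \<le> d" "j \<le> d" for i j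
    using N_space_symmetric_fun[OF that, of "\<Phi> i j"] sym by metis
  then obtain Y where Y: "\<And>i j. i \<le> d \<Longrightarrow> j \<le> d \<Longrightarrow> Y i j \<in> N_space d i j"
    and Y_val: "\<And>i j a b a' b'. i \<le> d \<Longrightarrow> j \<le> d \<Longrightarrow> a \<in> ksub d i \<Longrightarrow> b \<in> ksub d i \<Longrightarrow> a' \<in> ksub d j \<Longrightarrow> b' \<in> ksub d j
       \<Longrightarrow> Y i j ({1..d} - a, b) ({1..d} - a', b') = \<Phi> i j (card (a \<inter> a')) (card (b \<inter> b'))"
    by metis
  have "M = (\<Sum>i\<le>d. \<Sum>j\<le>d. embed_block d x f g i j (Y i j))"
  proof (rule mats_eqI)
    show "M \<in> mats X X" using M unfolding orbit_algebra_def by blast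
    show "(\<Sum>i\<le>d. \<Sum>j\<le>d. embed_block d x f g i j (Y i j)) \<in> mats X X"
      by (intro mats_sum) (auto simp: mats_def embed_block_def block_def)
    fix y z assume mem: "y \<in> X" "z \<in> X"
    obtain a b where y: "coords y = (a, b)" by (cases "coords y")
    obtain a' b' where z: "coords z = (a', b')" by (cases "coords z")
    have sub: "a \<subseteq> {1..d}" "b \<subseteq> {1..d}" "a' \<subseteq> {1..d}" "b' \<subseteq> {1..d}" "card a = card b" "card a' = card b'"
      using coords_in[OF mem(1)] coords_in[OF mem(2)] unfolding y z eqpairs_def by auto
    have le: "card a \<le> d" "card a' \<le> d"
      using sub card_mono[of "{1..d}" a] card_mono[of "{1..d}" a'] by auto
    have blk: "y \<in> block d x i \<longleftrightarrow> i = card a" "z \<in> block d x i \<longleftrightarrow> i = card a'" if "i \<le> d" for i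
      using block_iff_coords[OF mem(1) that] block_iff_coords[OF mem(2) that] sub
      unfolding y z ksub_def by auto
    have "(\<Sum>i\<le>d. \<Sum>j\<le>d. embed_block d x f g i j (Y i j)) y z
        = (\<Sum>i\<le>d. \<Sum>j\<le>d. embed_block d x f g i j (Y i j) y z)"
      by (simp only: sum_mat_apply)
    also have "\<dots> = (\<Sum>i\<le>d. \<Sum>j\<le>d. if j = card a' then if i = card a then M y z else 0 else 0)"
    proof (intro sum.cong refl)
      fix i j assume "i \<in> {..d}" "j \<in> {..d}"
      then have ij: "i \<le> d" "j \<le> d" by auto
      have "Y i j (split_set x f g y) (split_set x f g z) = M y z" if "i = card a" "j = card a'"
        unfolding split_set_coords y z fst_conv snd_conv
        using Y_val[OF ij, of a b a' b'] sub that \<Phi>[OF mem, of i j] y z by (auto simp: ksub_def)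
      then show "embed_block d x f g i j (Y i j) y z
          = (if j = card a' then if i = card a then M y z else 0 else 0)"
        unfolding embed_block_def blk(1)[OF ij(1)] blk(2)[OF ij(2)] by auto
    qed
    also have "\<dots> = M y z" using le by simp
    finally show "M y z = (\<Sum>i\<le>d. \<Sum>j\<le>d. embed_block d x f g i j (Y i j)) y z" by simp
  qed
  then show "M \<in> N_total d x f g" unfolding N_total_def using Y by blast
qed

section \<open>The block space lies in the Terwilliger algebra\<close>

lemma terwilliger_gen:
  assumes "i \<le> d"
  shows "assoc_mat d i \<in> terwilliger d x" "dual_idem d x i \<in> terwilliger d x"
  unfolding terwilliger_def hull_def using assms by auto

lemma terwilliger_mmul:
  assumes "M \<in> terwilliger d x" "N \<in> terwilliger d x"
  shows "mmul X M N \<in> terwilliger d x"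
  using assms unfolding terwilliger_def hull_def is_subalgebra_def by blast

lemma terwilliger_subspace: "mat_space.subspace (terwilliger d x)"
  unfolding terwilliger_def hull_def
  by (rule mat_space.subspace_Inter) (auto simp: is_subalgebra_def)

text \<open>The matrix on \<open>X\<close> that corresponds to a matrix indexed by pairs of subsets.\<close>

definition lift_mat :: "(nat set \<times> nat set, nat set \<times> nat set) cmatrix \<Rightarrow> (nat set, nat set) cmatrix" where
  "lift_mat M = (\<lambda>y z. if y \<in> X \<and> z \<in> X then M (coords y) (coords z) else 0)"

lemma lift_mat_add: "lift_mat (M + N) = lift_mat M + lift_mat N"
  by (simp add: lift_mat_def fun_eq_iff)

lemma lift_mat_mscale: "lift_mat (mscale c M) = mscale c (lift_mat M)"
  by (simp add: lift_mat_def mscale_def fun_eq_iff)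

lemma lift_mat_mmul:
  assumes "M \<in> mats K (ksub d k \<times> ksub d k)"
  shows "lift_mat (mmul (ksub d k \<times> ksub d k) M N) = mmul X (lift_mat M) (lift_mat N)"
proof (intro ext)
  fix y z
  let ?P = "ksub d k \<times> ksub d k"
  have sub: "?P \<subseteq> eqpairs d" by (auto simp: eqpairs_def ksub_def)
  have fin: "finite (eqpairs d)"
    by (rule finite_subset[of _ "Pow {1..d} \<times> Pow {1..d}"]) (auto simp: eqpairs_def)
  show "lift_mat (mmul ?P M N) y z = mmul X (lift_mat M) (lift_mat N) y z"
  proof (cases "y \<in> X \<and> z \<in> X")
    case True
    have "mmul X (lift_mat M) (lift_mat N) y z
        = (\<Sum>w\<in>X. M (coords y) (coords w) * N (coords w) (coords z))"
      unfolding mmul_def lift_mat_def using True by (intro sum.cong) auto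
    also have "\<dots> = (\<Sum>u\<in>eqpairs d. M (coords y) u * N u (coords z))"
      by (rule sum.reindex_bij_betw[OF bij_coords])
    also have "\<dots> = (\<Sum>u\<in>?P. M (coords y) u * N u (coords z))"
      by (rule sum.mono_neutral_right[OF fin sub]) (simp add: matsD[OF assms])
    finally show ?thesis using True unfolding lift_mat_def mmul_def by simp
  qed (auto simp: lift_mat_def mmul_def)
qed

lemma dual_idem_mmul:
  assumes "M \<in> mats X X"
  shows "mmul X (dual_idem d x i) M y z = (if y \<in> block d x i then M y z else 0)"
    and "mmul X M (dual_idem d x i) y z = (if z \<in> block d x i then M y z else 0)"
proof -
  have "mmul X (dual_idem d x i) M y z = (\<Sum>w\<in>X. if y = w then (if y \<in> block d x i then M y z else 0) else 0)"
    unfolding mmul_def dual_idem_def rel_iff_block by (intro sum.cong) auto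
  also have "\<dots> = (if y \<in> block d x i then M y z else 0)"
    using block_sub finite_ksub by (simp add: sum.delta)
  finally show "mmul X (dual_idem d x i) M y z = (if y \<in> block d x i then M y z else 0)" .
  have "mmul X M (dual_idem d x i) y z = (\<Sum>w\<in>X. if w = z then (if z \<in> block d x i then M y z else 0) else 0)"
    unfolding mmul_def dual_idem_def rel_iff_block by (intro sum.cong) auto
  also have "\<dots> = (if z \<in> block d x i then M y z else 0)"
    using block_sub finite_ksub by (simp add: sum.delta)
  finally show "mmul X M (dual_idem d x i) y z = (if z \<in> block d x i then M y z else 0)" .
qed

text \<open>The block of \<open>A\<^sub>k\<close> with rows in the \<open>i\<close>-th and columns in the \<open>j\<close>-th subconstituent, in
  coordinates.\<close>

definition dist_block :: "nat \<Rightarrow> nat \<Rightarrow> nat \<Rightarrow> (nat set \<times> nat set, nat set \<times> nat set) cmatrix" where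
  "dist_block k i j = (\<lambda>(a, b) (a', b').
     if a \<in> ksub d i \<and> b \<in> ksub d i \<and> a' \<in> ksub d j \<and> b' \<in> ksub d j
       \<and> card (a \<inter> a') + card (b \<inter> b') + k = i + j then 1 else 0)"

lemma lift_dist_block:
  assumes ij: "i \<le> d" "j \<le> d"
  shows "lift_mat (dist_block k i j) y z
     = (if y \<in> block d x i \<and> z \<in> block d x j \<and> card (y \<inter> z) + k = d then 1 else 0)"
proof (cases "y \<in> X \<and> z \<in> X")
  case True
  obtain a b where y: "coords y = (a, b)" by (cases "coords y")
  obtain a' b' where z: "coords z = (a', b')" by (cases "coords z")
  have blk: "y \<in> block d x i \<longleftrightarrow> a \<in> ksub d i \<and> b \<in> ksub d i"
    "z \<in> block d x j \<longleftrightarrow> a' \<in> ksub d j \<and> b' \<in> ksub d j"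
    using block_iff_coords[of y i] block_iff_coords[of z j] True ij unfolding y z by simp_all
  have "card (y \<inter> z) + card a + card a' = d + card (a \<inter> a') + card (b \<inter> b')"
    using card_Int_coords[OF _ _ y z] True by simp
  then have "card (a \<inter> a') + card (b \<inter> b') + k = i + j \<longleftrightarrow> card (y \<inter> z) + k = d"
    if "a \<in> ksub d i" "a' \<in> ksub d j"
    using that unfolding ksub_def by (simp only: mem_Collect_eq) linarith
  then show ?thesis
    using True unfolding lift_mat_def dist_block_def y z blk by auto
next
  case False
  then show ?thesis using block_sub by (auto simp: lift_mat_def)
qed

text \<open>The lifted block is \<open>E\<^sub>i\<^sup>* A\<^sub>k E\<^sub>j\<^sup>*\<close> for \<open>k \<le> d\<close> and \<open>0\<close> otherwise.\<close>

lemma lift_dist_block_terwilliger: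
  assumes ij: "i \<le> d" "j \<le> d"
  shows "lift_mat (dist_block k i j) \<in> terwilliger d x"
proof (cases "k \<le> d")
  case True
  have A: "assoc_mat d k \<in> mats X X" and E: "dual_idem d x j \<in> mats X X"
    by (auto simp: mats_def assoc_mat_def dual_idem_def johnson_rel_def)
  have "lift_mat (dist_block k i j) = mmul X (dual_idem d x i) (mmul X (assoc_mat d k) (dual_idem d x j))"
  proof (intro ext)
    fix y z :: "nat set"
    have "card (y \<inter> z) + k = d \<longleftrightarrow> card (y \<inter> z) = d - k" using True by linarith
    then show "lift_mat (dist_block k i j) y z
        = mmul X (dual_idem d x i) (mmul X (assoc_mat d k) (dual_idem d x j)) y z"
      unfolding lift_dist_block[OF ij] dual_idem_mmul(1)[OF mats_mmul[OF A E]] dual_idem_mmul(2)[OF A]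
      using block_sub[of y i] block_sub[of z j] by (simp add: assoc_mat_def johnson_rel_def)
  qed
  then show ?thesis
    using terwilliger_gen True ij by (simp add: terwilliger_mmul)
next
  case False
  have "lift_mat (dist_block k i j) = 0"
    using False by (intro ext) (simp add: lift_dist_block[OF ij])
  then show ?thesis using mat_space.subspace_0[OF terwilliger_subspace] by simp
qed

lemma mats_dist_block: "dist_block k i j \<in> mats (ksub d i \<times> ksub d i) (ksub d j \<times> ksub d j)"
  by (auto simp: mats_def dist_block_def)

lemma pair_mats_eqI:
  assumes "M \<in> mats (I \<times> I') (J \<times> J')" "N \<in> mats (I \<times> I') (J \<times> J')"
    and "\<And>a b a' b'. a \<in> I \<Longrightarrow> b \<in> I' \<Longrightarrow> a' \<in> J \<Longrightarrow> b' \<in> J' \<Longrightarrow> M (a, b) (a', b') = N (a, b) (a', b')"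
  shows "M = N"
  using assms by (intro mats_eqI[of M "I \<times> I'" "J \<times> J'" N]) auto

text \<open>The blocks that are used: distances \<open>0, 1, 2\<close> within a subconstituent, and the minimal distance
  \<open>|i - j|\<close> between two of them, where both intersections are inclusions.\<close>

lemma kron_dist_block:
  shows "kron (mone (ksub d i)) (mone (ksub d i)) = dist_block 0 i i"
    and "kron (johnson_adj d i) (mone (ksub d i)) + kron (mone (ksub d i)) (johnson_adj d i) = dist_block 1 i i"
    and "kron (johnson_adj d i) (johnson_adj d i)
       + (kron (dist_two d i) (mone (ksub d i)) + kron (mone (ksub d i)) (dist_two d i)) = dist_block 2 i i"
    and "kron (incl_mat i j d) (incl_mat i j d) = dist_block (max i j - min i j) i j"
proof -
  note mats = mats_add mats_kron mats_mone mats_adj mats_inter mats_dist_block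
  have mats_two: "dist_two d i \<in> mats (ksub d i) (ksub d i)"
    by (auto simp: mats_def dist_two_def)
  have one: "mone (ksub d i) a a' = (if card (a \<inter> a') = i then 1 else 0)"
    if "a \<in> ksub d i" "a' \<in> ksub d i" for a a'
    using that unfolding inter_mat_mone[symmetric] by (simp add: inter_mat_def)
  have adj: "johnson_adj d i a a' = (if Suc (card (a \<inter> a')) = i then 1 else 0)"
    if "a \<in> ksub d i" "a' \<in> ksub d i" for a a'
    using that by (simp add: johnson_adj_def)
  have two: "dist_two d i a a' = (if Suc (Suc (card (a \<inter> a'))) = i then 1 else 0)"
    if "a \<in> ksub d i" "a' \<in> ksub d i" for a a'
    using that by (simp add: dist_two_def)
  have le: "card (a \<inter> a') \<le> i" if "a \<in> ksub d i" for a a' by (rule card_Int_le[OF that])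
  show "kron (mone (ksub d i)) (mone (ksub d i)) = dist_block 0 i i"
  proof (rule pair_mats_eqI)
    fix a b a' b' assume *: "a \<in> ksub d i" "b \<in> ksub d i" "a' \<in> ksub d i" "b' \<in> ksub d i"
    show "kron (mone (ksub d i)) (mone (ksub d i)) (a, b) (a', b') = dist_block 0 i i (a, b) (a', b')"
      using * le[OF *(1), of a'] le[OF *(2), of b'] by (auto simp: kron_def dist_block_def one)
  qed (intro mats)+
  show "kron (johnson_adj d i) (mone (ksub d i)) + kron (mone (ksub d i)) (johnson_adj d i) = dist_block 1 i i"
    (is "?M = _")
  proof (rule pair_mats_eqI)
    fix a b a' b' assume *: "a \<in> ksub d i" "b \<in> ksub d i" "a' \<in> ksub d i" "b' \<in> ksub d i"
    show "?M (a, b) (a', b') = dist_block 1 i i (a, b) (a', b')"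
      using * le[OF *(1), of a'] le[OF *(2), of b'] by (auto simp: kron_def dist_block_def one adj)
  qed (intro mats)+
  show "kron (johnson_adj d i) (johnson_adj d i)
       + (kron (dist_two d i) (mone (ksub d i)) + kron (mone (ksub d i)) (dist_two d i)) = dist_block 2 i i"
    (is "?M = _")
  proof (rule pair_mats_eqI)
    fix a b a' b' assume *: "a \<in> ksub d i" "b \<in> ksub d i" "a' \<in> ksub d i" "b' \<in> ksub d i"
    show "?M (a, b) (a', b') = dist_block 2 i i (a, b) (a', b')"
      using * le[OF *(1), of a'] le[OF *(2), of b'] by (auto simp: kron_def dist_block_def one adj two)
  qed (intro mats mats_two)+
  show "kron (incl_mat i j d) (incl_mat i j d) = dist_block (max i j - min i j) i j"
  proof (rule pair_mats_eqI)
    fix a b a' b' assume *: "a \<in> ksub d i" "b \<in> ksub d i" "a' \<in> ksub d j" "b' \<in> ksub d j"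
    have "card (a \<inter> a') \<le> min i j" "card (b \<inter> b') \<le> min i j"
      using card_Int_le[OF *(1)] card_Int_le[OF *(2)] card_Int_le'[OF *(3)] card_Int_le'[OF *(4)] by simp_all
    then have "card (a \<inter> a') = min i j \<and> card (b \<inter> b') = min i j
        \<longleftrightarrow> card (a \<inter> a') + card (b \<inter> b') + (max i j - min i j) = i + j"
      by linarith
    then show "kron (incl_mat i j d) (incl_mat i j d) (a, b) (a', b')
        = dist_block (max i j - min i j) i j (a, b) (a', b')"
      using * unfolding kron_def dist_block_def inter_mat_def by auto
  qed (intro mats)+
qed

lemma lift_sym_poly:
  assumes i: "i \<le> d"
  shows "lift_mat (kron (mat_poly (ksub d i) (johnson_adj d i) p) (mat_poly (ksub d i) (johnson_adj d i) q)
     + kron (mat_poly (ksub d i) (johnson_adj d i) q) (mat_poly (ksub d i) (johnson_adj d i) p)) \<in> terwilliger d x"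
proof -
  let ?P = "ksub d i \<times> ksub d i"
  let ?S = "{M \<in> mats ?P ?P. lift_mat M \<in> terwilliger d x}"
  have "mat_space.subspace ?S"
  proof (rule mat_space.subspaceI)
    have "lift_mat 0 = 0" by (simp add: lift_mat_def fun_eq_iff)
    then show "0 \<in> ?S"
      using mat_space.subspace_0[OF terwilliger_subspace] mats_zero by (simp del: zero_fun_apply)
    show "M + N \<in> ?S" if "M \<in> ?S" "N \<in> ?S" for M N
      using that mats_add[of M ?P ?P N] mat_space.subspace_add[OF terwilliger_subspace]
      unfolding mem_Collect_eq lift_mat_add by blast
    show "mscale c M \<in> ?S" if "M \<in> ?S" for c M
      using that mats_mscale[of M ?P ?P c] mat_space.subspace_scale[OF terwilliger_subspace]
      unfolding mem_Collect_eq lift_mat_mscale by blast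
  qed
  moreover have "mmul ?P M N \<in> ?S" if "M \<in> ?S" "N \<in> ?S" for M N
    using that mats_mmul lift_mat_mmul terwilliger_mmul by auto
  moreover have "dist_block k i i \<in> ?S" for k
    using lift_dist_block_terwilliger[OF i i] by (auto simp: mats_def dist_block_def)
  ultimately have "kron (mat_poly (ksub d i) (johnson_adj d i) p) (mat_poly (ksub d i) (johnson_adj d i) q)
     + kron (mat_poly (ksub d i) (johnson_adj d i) q) (mat_poly (ksub d i) (johnson_adj d i) p) \<in> ?S"
    by (intro symmetric_poly_generated) (simp_all only: kron_dist_block)
  then show ?thesis by (rule CollectE) (rule conjunct2)
qed

text \<open>Complementing the first factor turns the generators of the block space into symmetrised
  products with equal factors on both sides.\<close>

lemma embed_N_gen:
  assumes ij: "i \<le> d" "j \<le> d"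
  shows "embed_block d x f g i j (N_gen d i j r s)
     = lift_mat (kron (idem_incl d i j r) (idem_incl d i j s) + kron (idem_incl d i j s) (idem_incl d i j r))"
    (is "_ = lift_mat ?M")
proof (intro ext)
  fix y z
  have M: "?M \<in> mats (ksub d i \<times> ksub d i) (ksub d j \<times> ksub d j)"
    by (intro mats_add mats_kron mats_idem_incl ij)
  show "embed_block d x f g i j (N_gen d i j r s) y z = lift_mat ?M y z"
  proof (cases "y \<in> block d x i \<and> z \<in> block d x j")
    case True
    then have mem: "y \<in> X" "z \<in> X" using block_sub by auto
    obtain a b where y: "coords y = (a, b)" by (cases "coords y")
    obtain a' b' where z: "coords z = (a', b')" by (cases "coords z")
    have sub: "a \<in> ksub d i" "b \<in> ksub d i" "a' \<in> ksub d j" "b' \<in> ksub d j"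
      using True block_iff_coords[OF mem(1) ij(1)] block_iff_coords[OF mem(2) ij(2)] unfolding y z by simp_all
    have "embed_block d x f g i j (N_gen d i j r s) y z = N_gen d i j r s ({1..d} - a, b) ({1..d} - a', b')"
      unfolding embed_block_def split_set_coords y z using True by simp
    also have "\<dots> = ?M (a, b) (a', b')"
      unfolding N_gen_eq by (simp only: plus_fun_apply kron_def prod.case idem_incl_compl[OF ij sub(1,3)])
    finally show ?thesis using mem by (simp add: lift_mat_def y z)
  next
    case False
    then show ?thesis
      using matsD[OF M, of "coords y" "coords z"] block_iff_coords[of y i] block_iff_coords[of z j] ij
      unfolding embed_block_def lift_mat_def by auto
  qed
qed

text \<open>The generator is the product of \<open>E\<^sub>r \<otimes> E\<^sub>s + E\<^sub>s \<otimes> E\<^sub>r\<close>, a symmetric polynomial in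
  \<open>A \<otimes> 1\<close> and \<open>1 \<otimes> A\<close>, with \<open>H \<otimes> H\<close>.\<close>

lemma embed_N_gen_terwilliger:
  assumes ij: "i \<le> d" "j \<le> d"
  shows "embed_block d x f g i j (N_gen d i j r s) \<in> terwilliger d x"
proof -
  let ?P = "ksub d i \<times> ksub d i" and ?E = "prim_idem d i"
  let ?S = "kron (?E r) (?E s) + kron (?E s) (?E r)" and ?H = "kron (incl_mat i j d) (incl_mat i j d)"
  have S: "?S \<in> mats ?P ?P" by (intro mats_add mats_kron mats_prim_idem ij)
  have "kron (idem_incl d i j r) (idem_incl d i j s) + kron (idem_incl d i j s) (idem_incl d i j r) = mmul ?P ?S ?H"
    by (simp only: idem_incl_def mmul_add_left mmul_kron)
  then have "embed_block d x f g i j (N_gen d i j r s) = mmul X (lift_mat ?S) (lift_mat ?H)"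
    by (simp only: embed_N_gen[OF ij] lift_mat_mmul[OF S])
  moreover have "lift_mat ?S \<in> terwilliger d x"
  proof -
    obtain p where p: "?E r = mat_poly (ksub d i) (johnson_adj d i) p" using prim_idem_poly[OF ij(1)] .
    obtain q where q: "?E s = mat_poly (ksub d i) (johnson_adj d i) q" using prim_idem_poly[OF ij(1)] .
    show ?thesis unfolding p q by (rule lift_sym_poly[OF ij(1)])
  qed
  moreover have "lift_mat ?H \<in> terwilliger d x"
    unfolding kron_dist_block by (rule lift_dist_block_terwilliger[OF ij])
  ultimately show ?thesis by (simp only: terwilliger_mmul)
qed

lemma N_total_sub_terwilliger: "N_total d x f g \<subseteq> terwilliger d x"
proof -
  have block: "embed_block d x f g i j Y \<in> terwilliger d x"
    if ij: "i \<le> d" "j \<le> d" and Y: "Y \<in> N_space d i j" for i j Y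
  proof -
    let ?S = "{Y. embed_block d x f g i j Y \<in> terwilliger d x}"
    have "mat_space.subspace ?S"
    proof (rule mat_space.subspaceI)
      have "embed_block d x f g i j 0 = 0" by (simp add: embed_block_def fun_eq_iff)
      then show "0 \<in> ?S"
        using mat_space.subspace_0[OF terwilliger_subspace] by (simp del: zero_fun_apply)
      have "embed_block d x f g i j (M + N) = embed_block d x f g i j M + embed_block d x f g i j N" for M N
        by (simp add: embed_block_def fun_eq_iff)
      then show "M + N \<in> ?S" if "M \<in> ?S" "N \<in> ?S" for M N
        using that mat_space.subspace_add[OF terwilliger_subspace] by (simp del: plus_fun_apply)
      have "embed_block d x f g i j (mscale c M) = mscale c (embed_block d x f g i j M)" for c M
        by (simp add: embed_block_def fun_eq_iff mscale_def)
      then show "mscale c M \<in> ?S" if "M \<in> ?S" for c M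
        using that mat_space.subspace_scale[OF terwilliger_subspace] by simp
    qed
    moreover have "{N_gen d i j r s | r s. r \<le> s \<and> s \<le> min d (d - i)} \<subseteq> ?S"
      using embed_N_gen_terwilliger[OF ij] by blast
    ultimately have "N_space d i j \<subseteq> ?S"
      unfolding N_space_def by (intro mat_space.span_minimal)
    then show ?thesis using Y by blast
  qed
  show ?thesis
    unfolding N_total_def
    by (auto intro!: mat_space.subspace_sum[OF terwilliger_subspace] block)
qed

end

theorem theorem5p1:
  fixes d :: nat and x :: "nat set" and f g :: "nat \<Rightarrow> nat"
  assumes "d > 0"
    and "x \<in> ksub (2 * d) d"
    and "bij_betw f x {1..d}"
    and "bij_betw g ({1..2 * d} - x) {1..d}"
  shows "terwilliger d x = N_total d x f g"
proof -
  interpret base_vertex d x f g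
    using assms(2-4) by unfold_locales
  show ?thesis
    using terwilliger_sub_orbit orbit_sub_N_total N_total_sub_terwilliger by blast
qed

end
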